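(* Let $n\ge 1$ and let $g$ be a (smooth) Lorentzian metric on $\mathbb{R}^{n+1}$. Suppose that $g$ is asymptotically Minkowski and that $(\mathbb{R}^{n+1},g)$ is null non-trapping. Then $(\mathbb{R}^{n+1},g)$ is geodesically complete, i.e. every maximally extended geodesic of $g$ (null, timelike or spacelike) is defined for all values $t\in\mathbb{R}$ of its affine parameter.
   Context: Write $\langle x\rangle=(1+|x|^2)^{1/2}$. For $k\in\mathbb{R}$, $S^k(\mathbb{R}^{n+1})$ is the set of $a\in C^\infty(\mathbb{R}^{n+1})$ such that for every multi-index $\alpha$ there is $C_\alpha$ with $|\partial_x^\alpha a(x)|\le C_\alpha\langle x\rangle^{k-|\alpha|}$ for all $x$. The Minkowski metric is $g_0=-dx_1^2+dx_2^2+\dots+dx_{n+1}^2$, with inverse matrix $(g_0^{jk})=\mathrm{diag}(-1,1,\dots,1)$. A Lorentzian metric $g$ on $\mathbb{R}^{n+1}$ is called asymptotically Minkowski if there is $\mu>0$ such that the inverse matrix $g^{-1}(x)=(g^{jk}(x))_{j,k=1}^{n+1}$ satisfies $g^{jk}-g_0^{jk}\in S^{-\mu}(\mathbb{R}^{n+1})$ for all $j,k$. Let $(M,g)$ be a Lorentzian manifold and $\gamma:(-T_0,T_1)\to M$ a maximally extended geodesic. $\gamma$ is forward (resp. backward) non-trapping if for each $t_0\in(-T_0,T_1)$ the image of $\gamma|_{(t_0,T_1)}$ (resp. $\gamma|_{(-T_0,t_0]}$) fails to have compact closure in $M$. $\gamma$ is non-trapping if it is both forward and backward non-trapping. $(M,g)$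 is null non-trapping if every non-constant maximally extended null geodesic (i.e. with $g(\gamma',\gamma')=0$) is non-trapping. Completeness of null geodesics is not assumed. *)

theory Defs
  imports "HOL-Analysis.Analysis"
begin

text \<open>
  The space \<open>\<real>\<^sup>n\<^sup>+\<^sup>1\<close> is \<^typ>\<open>real ^ 'm\<close> with \<open>CARD('m) = n + 1\<close>. As its tangent bundle is trivial,
  a metric is a matrix-valued function \<open>g\<close>, with \<open>g x $ j $ k\<close> the component \<open>g\<^sub>j\<^sub>k(x)\<close>.
\<close>

section \<open>Partial derivatives, smooth functions, symbols\<close>

definition partial :: "'m \<Rightarrow> (real ^ 'm \<Rightarrow> real) \<Rightarrow> real ^ 'm \<Rightarrow> real"
  where "partial i f x = frechet_derivative f (at x) (axis i 1)"

text \<open>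
  A multi-index \<open>\<alpha>\<close> is encoded by a list of coordinates, in which \<open>i\<close> occurs \<open>\<alpha>\<^sub>i\<close> times, so that
  \<open>|\<alpha>|\<close> is the length of the list. The order of the list is irrelevant for smooth functions.
\<close>

definition partials :: "'m list \<Rightarrow> (real ^ 'm \<Rightarrow> real) \<Rightarrow> real ^ 'm \<Rightarrow> real"
  where "partials is f = foldr partial is f"

definition smooth :: "(real ^ 'm \<Rightarrow> real) \<Rightarrow> bool"
  where "smooth f \<longleftrightarrow> (\<forall>is. partials is f differentiable_on UNIV)"

definition japanese_bracket :: "real ^ 'm \<Rightarrow> real"
  where "japanese_bracket x = sqrt (1 + (norm x)\<^sup>2)"

definition symbol_class :: "real \<Rightarrow> (real ^ 'm \<Rightarrow> real) set"
  where "symbol_class k =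
    {a. smooth a \<and>
        (\<forall>is. \<exists>C. \<forall>x. \<bar>partials is a x\<bar> \<le> C * japanese_bracket x powr (k - real (length is)))}"

section \<open>Lorentzian metrics\<close>

text \<open>
  The index \<open>i\<close> is the one of the time coordinate (\<open>x\<^sub>1\<close> in the usual numbering). This matrix is
  its own inverse, so it represents both \<open>(g\<^sub>0)\<^sub>j\<^sub>k\<close> and \<open>g\<^sub>0\<^sup>j\<^sup>k\<close>.
\<close>

definition minkowski :: "'m \<Rightarrow> real ^ 'm ^ 'm"
  where "minkowski i = (\<chi> j k. if j = k then (if j = i then -1 else 1) else 0)"

text \<open>
  Signature \<open>(-,+,\<dots>,+)\<close> at \<open>x\<close> is the existence of a frame (the columns of \<open>P\<close>) that is
  orthonormal for \<open>g(x)\<close>; the label \<open>i\<close> of the timelike vector of the frame is immaterial.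
\<close>

definition lorentzian_metric :: "(real ^ 'm \<Rightarrow> real ^ 'm ^ 'm) \<Rightarrow> bool"
  where "lorentzian_metric g \<longleftrightarrow>
    (\<forall>j k. smooth (\<lambda>x. g x $ j $ k)) \<and>
    (\<forall>x. transpose (g x) = g x) \<and>
    (\<forall>x. \<exists>(P :: real ^ 'm ^ 'm) i. invertible P \<and> transpose P ** g x ** P = minkowski i)"

definition inverse_metric :: "(real ^ 'm \<Rightarrow> real ^ 'm ^ 'm) \<Rightarrow> real ^ 'm \<Rightarrow> real ^ 'm ^ 'm"
  where "inverse_metric g x = matrix_inv (g x)"

definition asymptotically_minkowski :: "'m \<Rightarrow> (real ^ 'm \<Rightarrow> real ^ 'm ^ 'm) \<Rightarrow> bool"
  where "asymptotically_minkowski i g \<longleftrightarrow>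
    (\<exists>\<mu>>0. \<forall>j k.
       (\<lambda>x. inverse_metric g x $ j $ k - minkowski i $ j $ k) \<in> symbol_class (- \<mu>))"

section \<open>Geodesics\<close>

definition christoffel ::
    "(real ^ 'm \<Rightarrow> real ^ 'm ^ 'm) \<Rightarrow> 'm \<Rightarrow> 'm \<Rightarrow> 'm \<Rightarrow> real ^ 'm \<Rightarrow> real"
  where "christoffel g i j k x =
    (1/2) * (\<Sum>l\<in>UNIV. inverse_metric g x $ i $ l *
      (partial j (\<lambda>y. g y $ k $ l) x + partial k (\<lambda>y. g y $ j $ l) x
        - partial l (\<lambda>y. g y $ j $ k) x))"

text \<open>
  \<open>I\<close> is a nonempty open interval, bounded or not: the \<open>(-T\<^sub>0, T\<^sub>1)\<close> of the usual notation.
  The values of \<open>\<gamma>\<close> outside of \<open>I\<close> are irrelevant.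
\<close>

definition geodesic_on ::
    "(real ^ 'm \<Rightarrow> real ^ 'm ^ 'm) \<Rightarrow> real set \<Rightarrow> (real \<Rightarrow> real ^ 'm) \<Rightarrow> bool"
  where "geodesic_on g I \<gamma> \<longleftrightarrow>
    open I \<and> is_interval I \<and> I \<noteq> {} \<and>
    (\<exists>v. \<forall>t\<in>I.
       (\<gamma> has_vector_derivative v t) (at t) \<and>
       (v has_vector_derivative
          (\<chi> i. - (\<Sum>j\<in>UNIV. \<Sum>k\<in>UNIV. christoffel g i j k (\<gamma> t) * v t $ j * v t $ k))) (at t))"

definition maximal_geodesic ::
    "(real ^ 'm \<Rightarrow> real ^ 'm ^ 'm) \<Rightarrow> real set \<Rightarrow> (real \<Rightarrow> real ^ 'm) \<Rightarrow> bool"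
  where "maximal_geodesic g I \<gamma> \<longleftrightarrow>
    geodesic_on g I \<gamma> \<and>
    (\<forall>J \<delta>. geodesic_on g J \<delta> \<longrightarrow> I \<subseteq> J \<longrightarrow> (\<forall>t\<in>I. \<delta> t = \<gamma> t) \<longrightarrow> J = I)"

definition null_on ::
    "(real ^ 'm \<Rightarrow> real ^ 'm ^ 'm) \<Rightarrow> real set \<Rightarrow> (real \<Rightarrow> real ^ 'm) \<Rightarrow> bool"
  where "null_on g I \<gamma> \<longleftrightarrow>
    (\<forall>t\<in>I. vector_derivative \<gamma> (at t) \<bullet> (g (\<gamma> t) *v vector_derivative \<gamma> (at t)) = 0)"

definition forward_nontrapping :: "real set \<Rightarrow> (real \<Rightarrow> real ^ 'm) \<Rightarrow> bool"
  where "forward_nontrapping I \<gamma> \<longleftrightarrow> (\<forall>t\<^sub>0\<in>I. \<not> compact (closure (\<gamma> ` (I \<inter> {t\<^sub>0<..}))))"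

definition backward_nontrapping :: "real set \<Rightarrow> (real \<Rightarrow> real ^ 'm) \<Rightarrow> bool"
  where "backward_nontrapping I \<gamma> \<longleftrightarrow> (\<forall>t\<^sub>0\<in>I. \<not> compact (closure (\<gamma> ` (I \<inter> {..t\<^sub>0}))))"

definition nontrapping :: "real set \<Rightarrow> (real \<Rightarrow> real ^ 'm) \<Rightarrow> bool"
  where "nontrapping I \<gamma> \<longleftrightarrow> forward_nontrapping I \<gamma> \<and> backward_nontrapping I \<gamma>"

definition null_nontrapping :: "(real ^ 'm \<Rightarrow> real ^ 'm ^ 'm) \<Rightarrow> bool"
  where "null_nontrapping g \<longleftrightarrow>
    (\<forall>I \<gamma>. maximal_geodesic g I \<gamma> \<longrightarrow> null_on g I \<gamma> \<longrightarrow> \<not> \<gamma> constant_on I \<longrightarrow> nontrapping I \<gamma>)"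

definition geodesically_complete :: "(real ^ 'm \<Rightarrow> real ^ 'm ^ 'm) \<Rightarrow> bool"
  where "geodesically_complete g \<longleftrightarrow> (\<forall>I \<gamma>. maximal_geodesic g I \<gamma> \<longrightarrow> I = UNIV)"

end

(*
  Suppose a maximal geodesic stops at a finite parameter b. The Christoffel symbols are
  O(<x>^(-1-mu)), hence bounded, so the speed |v| must blow up like 1/(b-t). Far out the geodesic
  is almost straight: once it moves outwards there, integrability of <x>^(-1-mu) along it bounds
  |v|, a contradiction. Hence it never moves outwards far out and stays in a compact set K. In
  Euclidean arclength it survives for an infinite time in K, with unit velocity w and
  g(w,w) = const/|v|^2 -> 0. An omega-limit of this curve is a null pregeodesic on the whole line
  inside K. Its affine reparametrisation is a maximal geodesic, because it has infinite length in
  both directions, and it is null, nonconstant and trapped, contradicting null nontrapping.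
  No completeness of the limit is needed. The other endpoint follows by reversing time.
*)
theory Submission
  imports "HOL-Complex_Analysis.Great_Picard" Defs
begin

section \<open>Functions that are Lipschitz on bounded sets\<close>

text \<open>The blow-up rate comes from 1/|v|: as |acc| \<le> C |v|^2, this function is C-Lipschitz,
  so if |v| is unbounded near b then 1/|v| \<le> C (b - t). This one inequality makes the integral
  of |v| diverge logarithmically, which is the infinite Euclidean arclength, and it sends
  energy/|v|^2 to 0, so that timelike and spacelike geodesics lead to a null one too. As the
  velocities blow up, the limit is taken in arclength: there the equation is autonomous on pairs
  (position, unit direction), the orbit is bounded, and limits of its translates solve the same
  equation. Back in an affine parameter the limit may live on a bounded interval; it is maximal all
  the same, because a continuation past a finite endpoint would have bounded speed, hence finite
  length, up to it. A second obstacle is that decay is assumed for the inverse metric; boundedness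
  of g and decay of its derivatives have to be deduced. The dynamics is done for an abstract
  acceleration quadratic in the velocity, with a conserved quadratic function Q in place of the
  energy.\<close>

definition lipschitz_on_balls :: "('a::real_normed_vector \<Rightarrow> 'b::real_normed_vector) \<Rightarrow> bool"
  where "lipschitz_on_balls f \<longleftrightarrow> (\<forall>R. \<exists>L. L-lipschitz_on (cball 0 R) f)"

lemma lipschitz_on_balls_bounded_on:
  assumes "lipschitz_on_balls f" "bounded S"
  obtains L where "L-lipschitz_on S f"
proof -
  obtain R where "\<forall>x\<in>S. norm x \<le> R"
    using assms(2) by (auto simp: bounded_iff)
  then have "S \<subseteq> cball 0 R"
    by auto
  then show ?thesis
    using assms(1) that lipschitz_on_subset[of _ "cball 0 R" f S] unfolding lipschitz_on_balls_def by auto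
qed

lemma lipschitz_on_balls_isCont:
  assumes "lipschitz_on_balls f"
  shows "isCont f x"
proof -
  obtain L where "L-lipschitz_on (cball 0 (norm x + 1)) f"
    using assms by (auto simp: lipschitz_on_balls_def)
  then have "continuous_on (ball 0 (norm x + 1)) f"
    by (intro lipschitz_on_continuous_on) (rule lipschitz_on_subset, auto)
  then show ?thesis
    by (simp add: continuous_on_eq_continuous_at)
qed

lemma lipschitz_on_balls_continuous_on: "lipschitz_on_balls f \<Longrightarrow> continuous_on S f"
  by (simp add: continuous_at_imp_continuous_on lipschitz_on_balls_isCont)

lemma lipschitz_on_balls_bounded_image:
  assumes "lipschitz_on_balls f" "bounded S"
  shows "bounded (f ` S)"
proof -
  obtain L where L: "L-lipschitz_on S f"
    using assms by (rule lipschitz_on_balls_bounded_on)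
  obtain B where B: "\<And>x y. x \<in> S \<Longrightarrow> y \<in> S \<Longrightarrow> dist x y \<le> B"
    using assms(2) unfolding bounded_two_points by blast
  have "dist (f x) (f y) \<le> L * B" if "x \<in> S" "y \<in> S" for x y
    using lipschitz_onD[OF L that] mult_left_mono[OF B[OF that] lipschitz_on_nonneg[OF L]] by simp
  then show ?thesis
    by (auto simp: bounded_two_points)
qed

lemma lipschitz_on_balls_const: "lipschitz_on_balls (\<lambda>x. c)"
  unfolding lipschitz_on_balls_def using lipschitz_on_constant by blast

lemma lipschitz_on_balls_add:
  "lipschitz_on_balls f \<Longrightarrow> lipschitz_on_balls g \<Longrightarrow> lipschitz_on_balls (\<lambda>x. f x + g x)"
  unfolding lipschitz_on_balls_def using lipschitz_on_add by blast

lemma lipschitz_on_balls_minus: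
  "lipschitz_on_balls f \<Longrightarrow> lipschitz_on_balls (\<lambda>x. - f x)"
  unfolding lipschitz_on_balls_def using lipschitz_on_minus by blast

lemma lipschitz_on_balls_diff:
  "lipschitz_on_balls f \<Longrightarrow> lipschitz_on_balls g \<Longrightarrow> lipschitz_on_balls (\<lambda>x. f x - g x)"
  unfolding lipschitz_on_balls_def using lipschitz_on_diff by blast

lemma lipschitz_on_balls_sum:
  "(\<And>i. i \<in> A \<Longrightarrow> lipschitz_on_balls (f i)) \<Longrightarrow> lipschitz_on_balls (\<lambda>x. \<Sum>i\<in>A. f i x)"
  by (induction A rule: infinite_finite_induct)
    (auto intro: lipschitz_on_balls_add lipschitz_on_balls_const)

lemma lipschitz_on_balls_Pair:
  "lipschitz_on_balls f \<Longrightarrow> lipschitz_on_balls g \<Longrightarrow> lipschitz_on_balls (\<lambda>x. (f x, g x))"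
  unfolding lipschitz_on_balls_def using lipschitz_on_Pair by blast

lemma bounded_linear_lipschitz_on_balls: "bounded_linear f \<Longrightarrow> lipschitz_on_balls f"
  unfolding lipschitz_on_balls_def by (metis bounded_linear.lipschitz_boundE)

text \<open>The image of a ball need not lie in a ball of the same radius, but it is bounded, and
  that suffices for a constant of \<open>g\<close> on it. This is why the property is asked on every
  ball.\<close>

lemma lipschitz_on_balls_compose:
  assumes f: "lipschitz_on_balls f" and g: "lipschitz_on_balls g"
  shows "lipschitz_on_balls (\<lambda>x. g (f x))"
  unfolding lipschitz_on_balls_def
proof
  fix R
  obtain L where L: "L-lipschitz_on (cball 0 R) f"
    using f by (auto simp: lipschitz_on_balls_def)
  obtain M where "M-lipschitz_on (f ` cball 0 R) g"
    by (meson bounded_cball f g lipschitz_on_balls_bounded_image lipschitz_on_balls_bounded_on)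
  then show "\<exists>L. L-lipschitz_on (cball 0 R) (\<lambda>x. g (f x))"
    using L lipschitz_on_compose2 by blast
qed

lemma lipschitz_on_balls_bilinear:
  fixes f :: "'d::real_normed_vector \<Rightarrow> 'a::real_normed_vector"
    and p :: "'a \<Rightarrow> 'b::real_normed_vector \<Rightarrow> 'c::real_normed_vector"
  assumes "bounded_bilinear p" and f: "lipschitz_on_balls f" and g: "lipschitz_on_balls g"
  shows "lipschitz_on_balls (\<lambda>x. p (f x) (g x))"
  unfolding lipschitz_on_balls_def
proof
  interpret bounded_bilinear "p" by fact
  fix R
  obtain K where K: "K > 0" "\<And>a b. norm (p a b) \<le> norm a * norm b * K"
    using pos_bounded by blast
  obtain L where L: "L-lipschitz_on (cball 0 R) f"
    using f by (auto simp: lipschitz_on_balls_def)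
  obtain M where M: "M-lipschitz_on (cball 0 R) g"
    using g by (auto simp: lipschitz_on_balls_def)
  obtain A where A: "\<And>x. x \<in> cball 0 R \<Longrightarrow> norm (f x) \<le> A" "A > 0"
    using lipschitz_on_balls_bounded_image[OF f bounded_cball] unfolding bounded_pos by blast
  obtain B where B: "\<And>x. x \<in> cball 0 R \<Longrightarrow> norm (g x) \<le> B" "B > 0"
    using lipschitz_on_balls_bounded_image[OF g bounded_cball] unfolding bounded_pos by blast
  have "((A * M + L * B) * K)-lipschitz_on (cball 0 R) (\<lambda>x. p (f x) (g x))"
  proof (rule lipschitz_onI)
    fix x y :: 'd assume xy: "x \<in> cball 0 R" "y \<in> cball 0 R"
    have "p (f x) (g x) - p (f y) (g y) = p (f x) (g x - g y) + p (f x - f y) (g y)"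
      by (simp add: diff_left diff_right)
    then have "norm (p (f x) (g x) - p (f y) (g y))
        \<le> norm (p (f x) (g x - g y)) + norm (p (f x - f y) (g y))"
      by (metis norm_triangle_ineq)
    also have "\<dots> \<le> norm (f x) * norm (g x - g y) * K + norm (f x - f y) * norm (g y) * K"
      by (intro add_mono K)
    also have "\<dots> \<le> A * (M * norm (x - y)) * K + (L * norm (x - y)) * B * K"
      using A B K lipschitz_on_normD[OF L xy] lipschitz_on_normD[OF M xy] xy lipschitz_on_nonneg[OF L]
      by (intro add_mono mult_right_mono mult_mono) (auto simp: less_imp_le)
    finally show "dist (p (f x) (g x)) (p (f y) (g y)) \<le> (A * M + L * B) * K * dist x y"
      by (simp add: dist_norm algebra_simps)
  qed (use A B K lipschitz_on_nonneg[OF L] lipschitz_on_nonneg[OF M] in auto)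
  then show "\<exists>L. L-lipschitz_on (cball 0 R) (\<lambda>x. p (f x) (g x))"
    by blast
qed

lemmas lipschitz_on_balls_scaleR = lipschitz_on_balls_bilinear[OF bounded_bilinear_scaleR]
  and lipschitz_on_balls_inner = lipschitz_on_balls_bilinear[OF bounded_bilinear_inner]
  and lipschitz_on_balls_mult = lipschitz_on_balls_bilinear[OF bounded_bilinear_mult]

lemma lipschitz_on_balls_vec_lambda:
  fixes f :: "'a::real_normed_vector \<Rightarrow> 'm::finite \<Rightarrow> real"
  assumes "\<And>i. lipschitz_on_balls (\<lambda>x. f x i)"
  shows "lipschitz_on_balls (\<lambda>x. \<chi> i. f x i)"
proof -
  have "(\<lambda>x. \<chi> i. f x i) = (\<lambda>x. \<Sum>i\<in>UNIV. f x i *\<^sub>R axis i 1)"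
    by (simp add: fun_eq_iff vec_eq_iff sum_component axis_def sum.delta if_distrib cong: if_cong)
  then show ?thesis
    using assms by (auto intro!: lipschitz_on_balls_sum lipschitz_on_balls_scaleR lipschitz_on_balls_const)
qed

section \<open>Solutions of autonomous differential equations\<close>

lemma picard_globally_lipschitz:
  fixes F :: "'b::euclidean_space \<Rightarrow> 'b"
  assumes L: "L-lipschitz_on UNIV F" and M: "\<And>z. norm (F z) \<le> M"
    and h: "h \<ge> 0" "L * h < 1"
  obtains z where "z 0 = z0" "\<And>t. t \<in> {0..h} \<Longrightarrow> (z has_vector_derivative F (z t)) (at t within {0..h})"
proof -
  have contF: "continuous_on S F" for S
    using L lipschitz_on_continuous_on continuous_on_subset by blast
  have L0: "L \<ge> 0"
    using L lipschitz_on_nonneg by blast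
  \<comment> \<open>Clamping time to \<open>{0..h}\<close> lets the Picard operator act on bounded
    continuous functions on the whole line, a complete space; it reads its argument on
    \<open>{0..h}\<close> only, so its contraction factor is \<open>L * h\<close>.\<close>
  define c where "c t = max 0 (min h t)" for t :: real
  have c: "c t \<in> {0..h}" for t
    using h by (auto simp: c_def)
  have contc: "continuous_on S c" for S
    unfolding c_def by (intro continuous_intros)
  define T where "T f t = z0 + integral {0..c t} (\<lambda>s. F (apply_bcontfun f s))"
    for f :: "real \<Rightarrow>\<^sub>C 'b" and t
  have int: "(\<lambda>s. F (apply_bcontfun f s)) integrable_on {0..a}" for f :: "real \<Rightarrow>\<^sub>C 'b" and a
    by (intro integrable_continuous_real continuous_on_compose2[OF contF[of UNIV]]) auto
  have int_bound: "norm (integral {0..c t} (\<lambda>s. F (apply_bcontfun f s))) \<le> M * h" for f t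
  proof -
    have "M \<ge> 0"
      using norm_ge_zero[of "F 0"] M[of 0] by linarith
    have "norm (integral {0..c t} (\<lambda>s. F (apply_bcontfun f s))) \<le> M * (c t - 0)"
      using M c by (intro integral_bound continuous_on_compose2[OF contF[of UNIV]]) auto
    also have "\<dots> \<le> M * h"
      using c[of t] \<open>M \<ge> 0\<close> by (intro mult_left_mono) auto
    finally show ?thesis .
  qed
  have T: "T f \<in> bcontfun" for f
    unfolding bcontfun_def
  proof safe
    have "continuous_on {0..h} (\<lambda>u. integral {0..u} (\<lambda>s. F (apply_bcontfun f s)))"
      by (intro indefinite_integral_continuous_1 int)
    then show "continuous_on UNIV (T f)"
      unfolding T_def
      by (intro continuous_intros continuous_on_compose2[where g = "\<lambda>u. integral {0..u} _", OF _ contc])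
        (use c in auto)
    have "norm (T f t) \<le> norm z0 + M * h" for t
      unfolding T_def using int_bound[of t f] norm_triangle_ineq order_trans add_left_mono by blast
    then show "bounded (range (T f))"
      by (auto simp: bounded_iff)
  qed
  define \<Phi> where "\<Phi> f = Bcontfun (T f)" for f
  have \<Phi>: "apply_bcontfun (\<Phi> f) = T f" for f
    unfolding \<Phi>_def using T by (simp add: Bcontfun_inverse)
  have "dist (\<Phi> f) (\<Phi> g) \<le> (L * h) * dist f g" for f g
  proof (rule dist_bound)
    fix t
    have "dist (T f t) (T g t)
        = norm (integral {0..c t} (\<lambda>s. F (apply_bcontfun f s) - F (apply_bcontfun g s)))"
      unfolding T_def by (simp add: dist_norm integral_diff[OF int int])
    also have "\<dots> \<le> (L * dist f g) * (c t - 0)"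
    proof (rule integral_bound)
      fix s
      have "norm (F (apply_bcontfun f s) - F (apply_bcontfun g s))
          \<le> L * dist (apply_bcontfun f s) (apply_bcontfun g s)"
        using lipschitz_onD[OF L] by (simp add: dist_norm)
      also have "\<dots> \<le> L * dist f g"
        using L0 dist_bounded by (intro mult_left_mono) auto
      finally show "norm (F (apply_bcontfun f s) - F (apply_bcontfun g s)) \<le> L * dist f g" .
    qed (use c in \<open>auto intro!: continuous_intros continuous_on_compose2[OF contF[of UNIV]]\<close>)
    also have "\<dots> \<le> (L * dist f g) * h"
      using c[of t] L0 by (intro mult_left_mono) auto
    finally show "dist (apply_bcontfun (\<Phi> f) t) (apply_bcontfun (\<Phi> g) t) \<le> (L * h) * dist f g"
      by (simp add: \<Phi> algebra_simps)
  qed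
  then obtain z where "\<Phi> z = z"
    using banach_fix_type[of "L * h" \<Phi>] h L0 by auto
  then have z: "apply_bcontfun z t = T z t" for t
    using \<Phi> by metis
  show ?thesis
  proof
    show "apply_bcontfun z 0 = z0"
      using z[of 0] h by (simp add: T_def c_def)
    fix t assume t: "t \<in> {0..h}"
    have eq: "apply_bcontfun z u = z0 + integral {0..u} (\<lambda>s. F (apply_bcontfun z s))"
      if "u \<in> {0..h}" for u
      using z[of u] that by (simp add: T_def c_def)
    have cont: "continuous_on {0..h} (\<lambda>s. F (apply_bcontfun z s))"
      by (intro continuous_on_compose2[OF contF[of UNIV]]) auto
    have "((\<lambda>u. z0 + integral {0..u} (\<lambda>s. F (apply_bcontfun z s))) has_vector_derivative
        F (apply_bcontfun z t)) (at t within {0..h})"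
      using integral_has_vector_derivative[OF cont t] by (auto intro!: derivative_eq_intros)
    then show "(apply_bcontfun z has_vector_derivative F (apply_bcontfun z t)) (at t within {0..h})"
      by (rule has_vector_derivative_transform[OF t, rotated])
        (simp add: eq)
  qed
qed

lemma picard:
  fixes F :: "'b::euclidean_space \<Rightarrow> 'b"
  assumes F: "lipschitz_on_balls F"
  obtains h z where "h > 0" "z 0 = z0"
    "\<And>t. t \<in> {0..h} \<Longrightarrow> (z has_vector_derivative F (z t)) (at t within {0..h})"
proof -
  define B where "B = cball z0 1"
  obtain L where L: "L-lipschitz_on B F"
    using F lipschitz_on_balls_bounded_on unfolding B_def by (metis bounded_cball)
  obtain M where M: "\<And>x. x \<in> B \<Longrightarrow> norm (F x) \<le> M" "M > 0"
    using lipschitz_on_balls_bounded_image[OF F bounded_cball] unfolding B_def bounded_pos by blast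
  \<comment> \<open>The projection onto the convex set \<open>B\<close> is 1-Lipschitz, so
    \<open>G\<close> inherits the constant and the bound of \<open>F\<close> on \<open>B\<close>
    while being defined everywhere.\<close>
  define G where "G x = F (closest_point B x)" for x
  have B: "closed B" "convex B" "B \<noteq> {}"
    by (auto simp: B_def)
  have in_B: "closest_point B x \<in> B" for x
    using B closest_point_in_set by blast
  have L0: "L \<ge> 0"
    using L lipschitz_on_nonneg by blast
  have G: "L-lipschitz_on UNIV G"
  proof (rule lipschitz_onI)
    fix x y
    have "dist (G x) (G y) \<le> L * dist (closest_point B x) (closest_point B y)"
      unfolding G_def using L in_B lipschitz_onD by blast
    also have "\<dots> \<le> L * dist x y"
      using L0 B closest_point_lipschitz by (intro mult_left_mono) auto
    finally show "dist (G x) (G y) \<le> L * dist x y" .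
  qed fact
  \<comment> \<open>The first entry gives \<open>L * h < 1\<close>, also when \<open>L = 0\<close>.
    The second gives \<open>M * h \<le> 1\<close>, so that the solution cannot leave the unit ball
    \<open>B\<close>, where \<open>G\<close> and \<open>F\<close> agree.\<close>
  define h where "h = min (1 / (L + 1)) (1 / M)"
  have h: "h > 0" "M * h \<le> 1"
    using L0 M(2) by (auto simp: h_def min_def field_simps)
  have "L * h \<le> L * (1 / (L + 1))"
    unfolding h_def using L0 by (intro mult_left_mono) auto
  also have "\<dots> < 1"
    using L0 by (simp add: field_simps)
  finally obtain z where z: "z 0 = z0"
    and z': "\<And>t. t \<in> {0..h} \<Longrightarrow> (z has_vector_derivative G (z t)) (at t within {0..h})"
    using picard_globally_lipschitz[OF G, of M h z0] M in_B h unfolding G_def by auto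
  have "z t \<in> B" if t: "t \<in> {0..h}" for t
  proof -
    have mono: "\<bar>u\<bar> * norm (F (closest_point B w)) \<le> M * \<bar>u\<bar>" for u w
      using mult_left_mono[OF M(1)[OF in_B], of "\<bar>u\<bar>" w] by (simp add: mult.commute)
    have "norm (z t - z 0) \<le> M * norm (t - 0)"
      using z' M in_B t h unfolding has_vector_derivative_def
      by (intro differentiable_bound[of "{0..h}" z "\<lambda>t x. x *\<^sub>R G (z t)"])
        (auto simp: G_def intro!: onorm_le mono)
    also have "\<dots> \<le> M * h"
      using t M by (intro mult_left_mono) auto
    also have "\<dots> \<le> 1"
      by fact
    finally show ?thesis
      by (simp add: B_def z dist_norm norm_minus_commute)
  qed
  then have "G (z t) = F (z t)" if "t \<in> {0..h}" for t
    using that by (simp add: G_def closest_point_self)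
  then show ?thesis
    using z z' h that by metis
qed

section \<open>Continuation of solutions past a finite endpoint\<close>

text \<open>The fundamental theorem of calculus tolerates one exceptional point, so \<open>f\<close>
  is an integral of the continuous \<open>f'\<close>, and such an integral is differentiable
  everywhere. This serves to glue two solutions.\<close>

lemma has_vector_derivative_removable_point:
  fixes f :: "real \<Rightarrow> 'b::banach"
  assumes "a < c" "c < b" and f: "continuous_on {a<..<b} f"
    and f': "\<And>t. t \<in> {a<..<b} - {c} \<Longrightarrow> (f has_vector_derivative f' t) (at t)"
    and cont: "continuous_on {a<..<b} f'"
  shows "(f has_vector_derivative f' c) (at c)"
proof -
  define p q where "p = (a + c) / 2" and "q = (c + b) / 2"
  have pq: "a < p" "p < c" "c < q" "q < b"
    using assms(1,2) by (auto simp: p_def q_def)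
  then have sub: "{p..q} \<subseteq> {a<..<b}"
    by auto
  have eq: "f t = f p + integral {p..t} f'" if "t \<in> {p..q}" for t
  proof -
    have "(f' has_integral (f t - f p)) {p..t}"
      by (rule fundamental_theorem_of_calculus_interior_strong[of "{c}"])
        (use that pq in \<open>auto intro!: f' continuous_on_subset[OF f]\<close>)
    then show ?thesis
      by (simp add: integral_unique)
  qed
  have "((\<lambda>u. f p + integral {p..u} f') has_vector_derivative f' c) (at c within {p..q})"
    using integral_has_vector_derivative[OF continuous_on_subset[OF cont sub], of c] pq
    by (auto intro!: derivative_eq_intros)
  then have "(f has_vector_derivative f' c) (at c within {p..q})"
    by (rule has_vector_derivative_transform[rotated 2]) (use pq in \<open>simp_all add: eq[symmetric]\<close>)
  then show ?thesis
    using pq at_within_interior[of c "{p..q}"] by simp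
qed

lemma bounded_solution_lipschitz:
  fixes F :: "'b::real_normed_vector \<Rightarrow> 'b"
  assumes z: "\<And>t. t \<in> S \<Longrightarrow> (z has_vector_derivative F (z t)) (at t)"
    and S: "convex S" and M: "\<And>t. t \<in> S \<Longrightarrow> norm (F (z t)) \<le> M" "M \<ge> 0"
  shows "M-lipschitz_on S z"
proof (rule bounded_derivative_imp_lipschitz[OF _ S _ M(2)])
  show "(z has_derivative (\<lambda>x. x *\<^sub>R F (z t))) (at t within S)" if "t \<in> S" for t
    using z[OF that] by (simp add: has_derivative_at_withinI has_vector_derivative_def)
  show "onorm (\<lambda>x. x *\<^sub>R F (z t)) \<le> M" if "t \<in> S" for t
    using mult_right_mono[OF M(1)[OF that]] by (intro onorm_le) (auto simp: mult.commute[of "\<bar>_\<bar>"])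
qed

lemma less_Sup_open_interval:
  fixes I :: "real set"
  assumes I: "open I" "bdd_above I" and t: "t \<in> I"
  shows "t < Sup I"
proof -
  obtain e where "e > 0" "ball t e \<subseteq> I"
    using I(1) t open_contains_ball by blast
  then have "t + e/2 \<in> I"
    by (auto simp: dist_real_def subset_eq)
  then have "t + e/2 \<le> Sup I"
    using I(2) cSup_upper by blast
  with \<open>e > 0\<close> show ?thesis
    by simp
qed

lemma open_interval_Int_atLeast:
  fixes I :: "real set"
  assumes I: "open I" "is_interval I" "bdd_above I" and t0: "t0 \<in> I"
  shows "I \<inter> {t0..} = {t0..<Sup I}"
proof -
  have "t \<in> I" if t: "t0 \<le> t" "t < Sup I" for t
  proof -
    obtain u where "u \<in> I" "t < u"
      using t(2) t0 less_cSup_iff[of I t] I(3) by blast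
    then show ?thesis
      using I(2) t0 t unfolding is_interval_1 by (meson less_imp_le)
  qed
  then show ?thesis
    using less_Sup_open_interval[OF I(1,3)] by force
qed

text \<open>A bounded orbit has bounded velocity \<open>F (z t)\<close>, so \<open>z\<close> is
  Lipschitz up to the endpoint and extends continuously to it. Picard iteration restarted from the
  limit value continues it.\<close>

lemma solution_continuation:
  fixes F :: "'b::euclidean_space \<Rightarrow> 'b"
  assumes F: "lipschitz_on_balls F"
    and I: "open I" "is_interval I" "bdd_above I" and "t0 \<in> I"
    and z: "\<And>t. t \<in> I \<Longrightarrow> (z has_vector_derivative F (z t)) (at t)"
    and bd: "bounded (z ` (I \<inter> {t0..}))"
  obtains J w where "open J" "is_interval J" "I \<subset> J" "\<And>t. t \<in> I \<Longrightarrow> w t = z t"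
    "\<And>t. t \<in> J \<Longrightarrow> (w has_vector_derivative F (w t)) (at t)"
proof -
  define b where "b = Sup I"
  have less_b: "t < b" if "t \<in> I" for t
    unfolding b_def using less_Sup_open_interval[OF I(1,3) that] .
  then have b_notin: "b \<notin> I"
    by blast
  have t0b: "t0 < b"
    using less_b \<open>t0 \<in> I\<close> .
  have I_eq: "I \<inter> {t0..} = {t0..<b}"
    unfolding b_def using open_interval_Int_atLeast[OF I \<open>t0 \<in> I\<close>] .
  have in_I: "t \<in> I" if "t0 \<le> t" "t < b" for t
  proof -
    have "t \<in> I \<inter> {t0..}"
      unfolding I_eq using that by simp
    then show ?thesis
      by simp
  qed
  obtain M where M: "\<And>t. t \<in> {t0..<b} \<Longrightarrow> norm (F (z t)) \<le> M" "M > 0"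
    using lipschitz_on_balls_bounded_image[OF F bd] unfolding bounded_pos I_eq by fastforce
  have "M-lipschitz_on {t0..<b} z"
    by (rule bounded_solution_lipschitz[of _ _ F]) (use z in_I M in auto)
  then obtain g where g: "M-lipschitz_on {t0..b} g" "\<And>t. t \<in> {t0..<b} \<Longrightarrow> g t = z t"
    using lipschitz_extend_closure[of M "{t0..<b}" z] t0b by auto
  obtain h y where h: "h > 0" and y: "y 0 = g b"
    "\<And>t. t \<in> {0..h} \<Longrightarrow> (y has_vector_derivative F (y t)) (at t within {0..h})"
    using picard[OF F] by blast
  define w where "w t = (if t < b then z t else y (t - b))" for t
  \<comment> \<open>The second interval starts at \<open>t0\<close> rather than at \<open>b\<close>,
    so that it overlaps \<open>I\<close>: the union is then open and connected.\<close>
  define J where "J = I \<union> {t0<..<b+h}"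
  have w_left: "(w has_vector_derivative F (w t)) (at t)" if "t \<in> I" for t
  proof -
    have "(z has_vector_derivative F (w t)) (at t)"
      using z[OF that] less_b[OF that] by (simp add: w_def)
    then show ?thesis
      by (rule has_vector_derivative_transform_within_open[of _ _ _ I])
        (use that I(1) less_b in \<open>auto simp: w_def\<close>)
  qed
  have w_right: "(w has_vector_derivative F (w t)) (at t)" if "t \<in> {b<..<b+h}" for t
  proof -
    have "(y has_vector_derivative F (y (t - b))) (at (t - b))"
      using y(2)[of "t - b"] that at_within_interior[of "t - b" "{0..h}"] by simp
    then have "((y \<circ> (\<lambda>u. u - b)) has_vector_derivative 1 *\<^sub>R F (y (t - b))) (at t)"
      by (intro vector_diff_chain_at) (auto intro!: derivative_eq_intros)
    then have "((\<lambda>u. y (u - b)) has_vector_derivative F (w t)) (at t)"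
      using that by (simp add: w_def o_def)
    then show ?thesis
      by (rule has_vector_derivative_transform_within_open[of _ _ _ "{b<..<b+h}"])
        (use that in \<open>auto simp: w_def\<close>)
  qed
  have conty: "continuous_on {0..h} y"
    using y(2) has_vector_derivative_continuous by (fastforce simp: continuous_on_eq_continuous_within)
  have "continuous_on ({t0..b} \<union> {b..<b+h}) (\<lambda>t. if t \<le> b then g t else y (t - b))"
  proof (rule continuous_on_cases_local)
    show "continuous_on {t0..b} g"
      using g(1) lipschitz_on_continuous_on by blast
    show "continuous_on {b..<b+h} (\<lambda>t. y (t - b))"
      by (intro continuous_on_compose2[OF conty] continuous_intros) auto
    show "closedin (top_of_set ({t0..b} \<union> {b..<b+h})) {t0..b}"
      by (rule closed_subset) auto
    have "{b..<b+h} = ({t0..b} \<union> {b..<b+h}) \<inter> {b..}"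
      using t0b h by auto
    then show "closedin (top_of_set ({t0..b} \<union> {b..<b+h})) {b..<b+h}"
      by (metis closed_atLeast closedin_closed_Int)
  qed (use y(1) in auto)
  moreover have "w t = (if t \<le> b then g t else y (t - b))" if "t \<ge> t0" for t
    using that y(1) g(2)[of t] by (auto simp: w_def)
  ultimately have "continuous_on ({t0..b} \<union> {b..<b+h}) w"
    using t0b by (subst continuous_on_cong[OF refl]) auto
  then have contw: "continuous_on {t0<..<b+h} w"
    by (rule continuous_on_subset) auto
  \<comment> \<open>At the junction \<open>picard\<close> supplies a derivative from the right only
    and \<open>z\<close> none at all; continuity of \<open>w\<close> and of \<open>F\<close> along
    \<open>w\<close> makes up for both.\<close>
  have "(w has_vector_derivative F (w b)) (at b)"
  proof (rule has_vector_derivative_removable_point[where a = t0 and b = "b + h" and f' = "\<lambda>t. F (w t)"])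
    fix t assume "t \<in> {t0<..<b+h} - {b}"
    then show "(w has_vector_derivative F (w t)) (at t)"
      using w_left[OF in_I, of t] w_right[of t] by (cases "t < b") auto
  next
    show "continuous_on {t0<..<b+h} (\<lambda>t. F (w t))"
      by (intro continuous_on_compose2[OF lipschitz_on_balls_continuous_on[OF F, of UNIV] contw]) auto
  qed (use t0b h contw in auto)
  then have "(w has_vector_derivative F (w t)) (at t)" if "t \<in> J" for t
    using that w_left[OF in_I, of t] w_left[of t] w_right[of t] unfolding J_def
    by (cases t b rule: linorder_cases) auto
  moreover have "open J"
    unfolding J_def using I(1) by auto
  moreover have "is_interval J"
  proof -
    have "(t0 + b) / 2 \<in> I \<inter> {t0<..<b+h}"
      using in_I[of "(t0 + b) / 2"] t0b h by auto
    then have "I \<inter> {t0<..<b+h} \<noteq> {}"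
      by blast
    moreover have "connected I" "connected {t0<..<b+h}"
      using I(2) by (simp_all add: is_interval_connected_1 connected_Ioo)
    ultimately have "connected J"
      unfolding J_def by (intro connected_Un)
    then show ?thesis
      by (simp add: is_interval_connected_1)
  qed
  moreover have "b \<in> J"
    using t0b h by (simp add: J_def)
  then have "I \<subset> J"
    using b_notin Un_upper1[of I "{t0<..<b+h}", folded J_def] by (metis psubsetI)
  moreover have "w t = z t" if "t \<in> I" for t
    using less_b[OF that] by (simp add: w_def)
  ultimately show ?thesis
    using that by metis
qed

section \<open>Reparametrisation and limits of solutions\<close>

lemma antiderivative_open_interval:
  fixes q :: "real \<Rightarrow> real"
  assumes J: "open J" "is_interval J" and "c \<in> J" and q: "continuous_on J q"
  obtains Q where "Q c = 0" "\<And>t. t \<in> J \<Longrightarrow> (Q has_real_derivative q t) (at t)"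
proof -
  \<comment> \<open>An integral over an empty interval is 0, so one of the two terms always vanishes
    and the difference is the signed integral from \<open>c\<close> to \<open>t\<close>.\<close>
  define Q where "Q t = integral {c..t} q - integral {t..c} q" for t
  have "(Q has_real_derivative q t) (at t)" if "t \<in> J" for t
  proof -
    define u v where "u = min t c" and "v = max t c"
    have uv: "u \<in> J" "v \<in> J"
      using \<open>t \<in> J\<close> \<open>c \<in> J\<close> by (auto simp: u_def v_def min_def max_def)
    obtain d where d: "d > 0" "cball u d \<subseteq> J"
      using J(1) uv(1) open_contains_cball by blast
    obtain e where e: "e > 0" "cball v e \<subseteq> J"
      using J(1) uv(2) open_contains_cball by blast
    define a b where "a = u - d" and "b = v + e"
    have ab: "a < t" "t < b" "a < c" "c < b"
      using d e by (auto simp: a_def b_def u_def v_def)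
    have "a \<in> J" "b \<in> J"
      using d e by (auto simp: a_def b_def subset_eq dist_real_def)
    then have sub: "{a..b} \<subseteq> J"
      using J(2) unfolding is_interval_1 by (meson atLeastAtMost_iff subsetI)
    have int: "q integrable_on {r..s}" if "a \<le> r" "s \<le> b" for r s
      by (intro integrable_continuous_real continuous_on_subset[OF q]) (use sub that in auto)
    have eq: "Q s = integral {a..s} q - integral {a..c} q" if "s \<in> {a..b}" for s
      using Henstock_Kurzweil_Integration.integral_combine[of a c s q]
        Henstock_Kurzweil_Integration.integral_combine[of a s c q] int[of a s] int[of a c] that ab
      unfolding Q_def by (cases c s rule: linorder_cases) (auto simp: algebra_simps)
    have "((\<lambda>s. integral {a..s} q - integral {a..c} q) has_real_derivative q t) (at t within {a..b})"
      using integral_has_real_derivative[OF continuous_on_subset[OF q sub], of t] ab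
      by (auto intro!: derivative_eq_intros)
    then have "((\<lambda>s. integral {a..s} q - integral {a..c} q) has_real_derivative q t) (at t)"
      using ab at_within_interior[of t "{a..b}"] by simp
    then show ?thesis
      by (rule has_field_derivative_transform_within_open[of _ _ _ "{a<..<b}"])
        (use ab eq in auto)
  qed
  then show ?thesis
    using that[of Q] by (simp add: Q_def)
qed

text \<open>Serves both changes of parameter: from affine time to Euclidean arclength, and back for
  the limit curve.\<close>

lemma inv_into_of_increasing:
  fixes s :: "real \<Rightarrow> real"
  assumes J: "open J" "is_interval J"
    and s: "\<And>t. t \<in> J \<Longrightarrow> (s has_real_derivative \<rho> t) (at t)"
    and \<rho>: "\<And>t. t \<in> J \<Longrightarrow> \<rho> t > 0"
  shows "open (s ` J)" "is_interval (s ` J)" "inj_on s J"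
    "\<And>t. t \<in> J \<Longrightarrow> (inv_into J s has_real_derivative inverse (\<rho> t)) (at (s t))"
proof -
  have cont: "continuous_on J s"
    using s by (meson DERIV_isCont continuous_at_imp_continuous_on)
  have less: "s t < s u" if "t \<in> J" "u \<in> J" "t < u" for t u
  proof (rule DERIV_pos_imp_increasing[OF \<open>t < u\<close>])
    fix x assume "t \<le> x" "x \<le> u"
    then have "x \<in> J"
      using J(2) that unfolding is_interval_1 by blast
    then show "\<exists>y. (s has_real_derivative y) (at x) \<and> 0 < y"
      using s \<rho> by blast
  qed
  then show inj: "inj_on s J"
    by (auto simp: inj_on_def) (metis linorder_less_linear order_less_irrefl)
  show "open (s ` J)"
    using invariance_of_domain[OF cont J(1) inj] .
  show "is_interval (s ` J)"
    using cont J(2) by (simp add: is_interval_connected_1 connected_continuous_image)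
  show "(inv_into J s has_real_derivative inverse (\<rho> t)) (at (s t))" if "t \<in> J" for t
    by (rule has_field_derivative_inverse_strong[OF s[OF that] _ J(1) that cont])
      (use \<rho>[OF that] inj in auto)
qed

section \<open>Limits of translated solutions\<close>

text \<open>Arzela-Ascoli in pointwise form: a diagonal argument gives convergence at the rationals,
  and the common Lipschitz constant transfers the Cauchy property from a nearby rational to any
  real.\<close>

lemma lipschitz_convergent_subsequence:
  fixes f :: "nat \<Rightarrow> real \<Rightarrow> 'b::euclidean_space"
  assumes L: "\<And>n. L-lipschitz_on UNIV (f n)" and M: "\<And>n t. norm (f n t) \<le> M"
  obtains r l where "strict_mono (r :: nat \<Rightarrow> nat)" "\<And>t. (\<lambda>n. f (r n) t) \<longlonglongrightarrow> l t"
proof -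
  obtain r where r: "strict_mono (r :: nat \<Rightarrow> nat)"
    and conv: "\<And>t. t \<in> \<rat> \<Longrightarrow> \<exists>l. (\<lambda>n. f (r n) t) \<longlonglongrightarrow> l"
    using function_convergent_subsequence[OF countable_rat, of f M] M by blast
  have L0: "L \<ge> 0"
    using L lipschitz_on_nonneg by blast
  have "Cauchy (\<lambda>n. f (r n) t)" for t
  proof (rule metric_CauchyI)
    fix e :: real assume e: "e > 0"
    obtain q where q: "q \<in> \<rat>" "t < q" "q < t + e / (3 * (L + 1))"
      using Rats_dense_in_real[of t "t + e / (3 * (L + 1))"] e L0 by auto
    have "L * dist t q \<le> L * (e / (3 * (L + 1)))"
      using q L0 by (intro mult_left_mono) (auto simp: dist_real_def)
    also have "\<dots> < e / 3"
      using e L0 by (simp add: field_simps)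
    finally have d: "dist (f n t) (f n q) < e / 3" for n
      using lipschitz_onD[OF L[of n], of t q] by simp
    have "Cauchy (\<lambda>n. f (r n) q)"
      using conv[OF q(1)] LIMSEQ_imp_Cauchy by blast
    then obtain N where N: "\<And>m n. m \<ge> N \<Longrightarrow> n \<ge> N \<Longrightarrow> dist (f (r m) q) (f (r n) q) < e / 3"
      using metric_CauchyD[of _ "e / 3"] e by force
    have "dist (f (r m) t) (f (r n) t) < e" if "m \<ge> N" "n \<ge> N" for m n
      using N[OF that] d[of "r m"] d[of "r n"]
        dist_triangle[of "f (r m) t" "f (r n) t" "f (r m) q"]
        dist_triangle[of "f (r m) q" "f (r n) t" "f (r n) q"]
      by (simp add: dist_commute)
    then show "\<exists>N. \<forall>m\<ge>N. \<forall>n\<ge>N. dist (f (r m) t) (f (r n) t) < e"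
      by blast
  qed
  then have "\<exists>l. (\<lambda>n. f (r n) t) \<longlonglongrightarrow> l" for t
    using Cauchy_convergent convergent_def by blast
  then show ?thesis
    using r that by metis
qed

text \<open>The translates of \<open>z\<close> by large times are uniformly bounded and
  equi-Lipschitz, and every fixed real time eventually falls into their domain. Hence the limit is a
  solution on the whole line although \<open>z\<close> is one on a half-line.\<close>

lemma omega_limit_solution:
  fixes F :: "'b::euclidean_space \<Rightarrow> 'b"
  assumes F: "lipschitz_on_balls F"
    and z: "\<And>t. t > 0 \<Longrightarrow> (z has_vector_derivative F (z t)) (at t)"
    and bd: "bounded (z ` {0<..})"
  obtains w \<sigma> where "filterlim \<sigma> at_top sequentially"
    "\<And>t. (\<lambda>n::nat. z (\<sigma> n + t)) \<longlonglongrightarrow> w t"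
    "\<And>t. (w has_vector_derivative F (w t)) (at t)"
proof -
  have contF: "continuous_on S F" for S
    using F by (rule lipschitz_on_balls_continuous_on)
  obtain M where M: "\<And>t. t > 0 \<Longrightarrow> norm (F (z t)) \<le> M" "M > 0"
    using lipschitz_on_balls_bounded_image[OF F bd] unfolding bounded_pos by fastforce
  obtain B where B: "\<And>t. t > 0 \<Longrightarrow> norm (z t) \<le> B"
    using bd unfolding bounded_iff by fastforce
  have lip: "M-lipschitz_on {0<..} z"
    by (rule bounded_solution_lipschitz[of _ _ F]) (use z M in auto)
  \<comment> \<open>The truncation by 1 keeps the argument in the domain of \<open>z\<close>, so
    that all \<open>f n\<close> are Lipschitz on the line; for each \<open>t\<close> it is inactive
    once \<open>n\<close> is large.\<close>
  define f where "f n t = z (max 1 (real n + t))" for n t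
  have f_lip: "M-lipschitz_on UNIV (f n)" for n
  proof (rule lipschitz_onI)
    fix t u :: real
    have "dist (f n t) (f n u) \<le> M * dist (max 1 (real n + t)) (max 1 (real n + u))"
      unfolding f_def by (intro lipschitz_onD[OF lip]) auto
    also have "\<dots> \<le> M * dist t u"
      using M(2) by (intro mult_left_mono) (auto simp: dist_real_def)
    finally show "dist (f n t) (f n u) \<le> M * dist t u" .
  qed (use M in auto)
  have f_bd: "norm (f n t) \<le> B" for n t
    unfolding f_def by (rule B) simp
  obtain r w where r: "strict_mono (r :: nat \<Rightarrow> nat)" and w: "\<And>t. (\<lambda>n. f (r n) t) \<longlonglongrightarrow> w t"
    using lipschitz_convergent_subsequence[of M f B, OF f_lip f_bd] by blast
  have r_top: "filterlim (\<lambda>n. real (r n)) at_top sequentially"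
    using filterlim_subseq[OF r] filterlim_real_sequentially filterlim_compose by blast
  have "\<forall>\<^sub>F n in sequentially. f (r n) t = z (real (r n) + t)" for t
    using r_top[unfolded filterlim_at_top, rule_format, of "1 - t"]
    by eventually_elim (auto simp: f_def max_def)
  then have conv: "(\<lambda>n. z (real (r n) + t)) \<longlonglongrightarrow> w t" for t
    using w[of t] by (rule Lim_transform_eventually[rotated])
  have w_lip: "M-lipschitz_on UNIV w"
  proof (rule lipschitz_onI)
    fix t u :: real
    show "dist (w t) (w u) \<le> M * dist t u"
      by (rule LIMSEQ_le_const2[OF tendsto_dist[OF w w]])
        (use lipschitz_onD[OF f_lip] in blast)
  qed (use M in auto)
  have cont: "continuous_on S (\<lambda>t. F (w t))" for S
    by (intro continuous_on_compose2[OF contF[of UNIV]] continuous_on_subset[OF lipschitz_on_continuous_on[OF w_lip]]) auto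
  \<comment> \<open>Pointwise limits do not carry derivatives along, so the limit is taken in the
    integral equation, by dominated convergence with the constant bound \<open>M\<close>.\<close>
  have eq: "w t = w a + integral {a..t} (\<lambda>s. F (w s))" if "a \<le> t" for a t
  proof -
    obtain N where N: "\<And>n. n \<ge> N \<Longrightarrow> real (r n) \<ge> 1 - a"
      using r_top[unfolded filterlim_at_top, rule_format, of "1 - a"]
      unfolding eventually_sequentially by auto
    have fd: "(f (r n) has_vector_derivative F (f (r n) s)) (at s within {a..t})"
      if "n \<ge> N" "s \<in> {a..t}" for n s
    proof -
      have "(z has_vector_derivative F (z (real (r n) + s))) (at (real (r n) + s))"
        using z[of "real (r n) + s"] N[of n] that by auto
      then have "((z \<circ> (\<lambda>s. real (r n) + s)) has_vector_derivative 1 *\<^sub>R F (z (real (r n) + s))) (at s)"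
        by (intro vector_diff_chain_at) (auto intro!: derivative_eq_intros)
      then have "((\<lambda>s. z (real (r n) + s)) has_vector_derivative F (z (real (r n) + s))) (at s within {a..t})"
        by (simp add: o_def has_vector_derivative_at_within)
      moreover have "f (r n) u = z (real (r n) + u)" if "u \<in> {a..t}" for u
        using N[of n] that \<open>n \<ge> N\<close> by (auto simp: f_def max_def)
      ultimately show ?thesis
        using that by (metis has_vector_derivative_transform)
    qed
    have fint: "((\<lambda>s. F (f (r n) s)) has_integral (f (r n) t - f (r n) a)) {a..t}" if "n \<ge> N" for n
      by (rule fundamental_theorem_of_calculus) (use fd that \<open>a \<le> t\<close> in auto)
    have "(\<lambda>n. integral {a..t} (\<lambda>s. F (f (r (n + N)) s))) \<longlonglongrightarrow> integral {a..t} (\<lambda>s. F (w s))"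
    proof (rule dominated_convergence(2)[where h = "\<lambda>_. M"])
      show "(\<lambda>s. F (f (r (n + N)) s)) integrable_on {a..t}" for n
        using fint[of "n + N"] by auto
      show "norm (F (f (r (n + N)) s)) \<le> M" for n s
        using M(1) by (auto simp: f_def)
      show "(\<lambda>n. F (f (r (n + N)) s)) \<longlonglongrightarrow> F (w s)" for s
        using isCont_tendsto_compose[OF lipschitz_on_balls_isCont[OF F] LIMSEQ_ignore_initial_segment[OF w]] .
    qed auto
    moreover have "integral {a..t} (\<lambda>s. F (f (r (n + N)) s)) = f (r (n + N)) t - f (r (n + N)) a" for n
      using fint[of "n + N"] by (simp add: integral_unique)
    moreover have "(\<lambda>n. f (r (n + N)) t - f (r (n + N)) a) \<longlonglongrightarrow> w t - w a"
      by (intro tendsto_diff LIMSEQ_ignore_initial_segment[OF w])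
    ultimately show ?thesis
      using LIMSEQ_unique by fastforce
  qed
  have "(w has_vector_derivative F (w t)) (at t)" for t
  proof -
    have "((\<lambda>u. w (t - 1) + integral {t - 1..u} (\<lambda>s. F (w s))) has_vector_derivative F (w t))
        (at t within {t - 1..t + 1})"
      using integral_has_vector_derivative[OF cont, of t "t - 1" "t + 1"]
      by (auto intro!: derivative_eq_intros)
    then have "(w has_vector_derivative F (w t)) (at t within {t - 1..t + 1})"
      by (rule has_vector_derivative_transform[rotated 2]) (simp_all add: eq[symmetric])
    then show ?thesis
      using at_within_interior[of t "{t - 1..t + 1}"] by simp
  qed
  then show ?thesis
    using that r_top conv by blast
qed

section \<open>Sprays with decaying coefficients\<close>

lemma has_real_derivative_inner:
  fixes f g :: "real \<Rightarrow> 'a::real_inner"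
  assumes "(f has_vector_derivative f') (at t)" "(g has_vector_derivative g') (at t)"
  shows "((\<lambda>t. f t \<bullet> g t) has_real_derivative (f t \<bullet> g' + f' \<bullet> g t)) (at t)"
  using bounded_bilinear.has_vector_derivative[OF bounded_bilinear_inner assms]
  by (simp add: has_real_derivative_iff_has_vector_derivative)

lemma has_real_derivative_norm:
  fixes f :: "real \<Rightarrow> 'a::real_inner"
  assumes f: "(f has_vector_derivative f') (at t)" and "f t \<noteq> 0"
  shows "((\<lambda>t. norm (f t)) has_real_derivative (f t \<bullet> f' / norm (f t))) (at t)"
proof -
  have "((\<lambda>t. sqrt (f t \<bullet> f t)) has_real_derivative (f t \<bullet> f' / norm (f t))) (at t)"
    using \<open>f t \<noteq> 0\<close>
    by (auto intro!: derivative_eq_intros has_real_derivative_inner f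
        simp: norm_eq_sqrt_inner inner_commute field_simps) (metis inner_ge_zero linorder_not_le)
  then show ?thesis
    by (simp add: norm_eq_sqrt_inner)
qed

section \<open>Motions of an abstract spray\<close>

text \<open>The velocity is kept as an explicit argument. Derivatives are two-sided whatever
  \<open>I\<close> is, so restriction to a half-open \<open>{t0..<b}\<close> keeps the equation at
  \<open>t0\<close>; \<open>motion\<close> adds the requirements on the domain made in
  \<open>geodesic_on\<close>.\<close>

definition trajectory :: "('a::real_normed_vector \<Rightarrow> 'a \<Rightarrow> 'a) \<Rightarrow> real set \<Rightarrow> (real \<Rightarrow> 'a) \<Rightarrow> (real \<Rightarrow> 'a) \<Rightarrow> bool"
  where "trajectory acc I x v \<longleftrightarrow> (\<forall>t\<in>I. (x has_vector_derivative v t) (at t) \<and>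
    (v has_vector_derivative acc (x t) (v t)) (at t))"

definition motion :: "('a::real_normed_vector \<Rightarrow> 'a \<Rightarrow> 'a) \<Rightarrow> real set \<Rightarrow> (real \<Rightarrow> 'a) \<Rightarrow> bool"
  where "motion acc I x \<longleftrightarrow> open I \<and> is_interval I \<and> I \<noteq> {} \<and> (\<exists>v. trajectory acc I x v)"

definition maximal_motion :: "('a::real_normed_vector \<Rightarrow> 'a \<Rightarrow> 'a) \<Rightarrow> real set \<Rightarrow> (real \<Rightarrow> 'a) \<Rightarrow> bool"
  where "maximal_motion acc I x \<longleftrightarrow> motion acc I x \<and>
    (\<forall>J y. motion acc J y \<longrightarrow> I \<subseteq> J \<longrightarrow> (\<forall>t\<in>I. y t = x t) \<longrightarrow> J = I)"

lemma trajectory_subset: "trajectory acc I x v \<Longrightarrow> J \<subseteq> I \<Longrightarrow> trajectory acc J x v"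
  unfolding trajectory_def by blast

lemma trajectory_continuous_on:
  assumes "trajectory acc I x v"
  shows "continuous_on I x" "continuous_on I v"
  using assms unfolding trajectory_def
  by (meson continuous_at_imp_continuous_on has_vector_derivative_continuous)+

text \<open>\<open>quadratic\<close> makes a change of parameter act on the acceleration by a scalar
  factor. The exponent in \<open>decay\<close> is that of first derivatives of a symbol of order
  -\<mu>, and it is integrable along a line going to infinity.\<close>

locale spray =
  fixes acc :: "'a::euclidean_space \<Rightarrow> 'a \<Rightarrow> 'a" and C \<mu> :: real
  assumes lipschitz: "lipschitz_on_balls (\<lambda>(x, v). acc x v)"
    and quadratic: "acc x (c *\<^sub>R v) = c\<^sup>2 *\<^sub>R acc x v"
    and decay: "norm (acc x v) \<le> C * (1 + norm x) powr (- 1 - \<mu>) * (norm v)\<^sup>2"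
    and C_pos: "C > 0" and mu_pos: "\<mu> > 0"
begin

lemma acc_bound: "norm (acc x v) \<le> C * (norm v)\<^sup>2"
proof -
  have "(1 + norm x) powr (- 1 - \<mu>) \<le> 1"
    using powr_mono[of "- 1 - \<mu>" 0 "1 + norm x"] mu_pos by (auto split: if_splits)
  then have "C * (1 + norm x) powr (- 1 - \<mu>) * (norm v)\<^sup>2 \<le> C * 1 * (norm v)\<^sup>2"
    using C_pos by (intro mult_right_mono mult_left_mono) auto
  then show ?thesis
    using decay[of x v] by simp
qed

section \<open>Speed and position near a finite endpoint\<close>

text \<open>On a bounded time interval a bounded velocity also bounds the position, so the orbit in
  phase space is bounded and could be continued.\<close>

lemma maximal_motion_unbounded_velocity:
  assumes max: "maximal_motion acc I x" and v: "trajectory acc I x v"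
    and I: "bdd_above I" and t0: "t0 \<in> I"
  shows "\<not> bounded (v ` {t0..<Sup I})"
proof
  assume bd: "bounded (v ` {t0..<Sup I})"
  have I': "open I" "is_interval I"
    using max unfolding maximal_motion_def motion_def by auto
  have I_eq: "I \<inter> {t0..} = {t0..<Sup I}"
    using open_interval_Int_atLeast[OF I' I t0] .
  define F where "F = (\<lambda>(x, v). (v, acc x v))"
  have F: "lipschitz_on_balls F"
    using lipschitz_on_balls_Pair[OF bounded_linear_lipschitz_on_balls[OF bounded_linear_snd] lipschitz]
    by (simp add: F_def case_prod_beta')
  obtain M where M: "\<And>t. t \<in> {t0..<Sup I} \<Longrightarrow> norm (v t) \<le> M" "M > 0"
    using bd unfolding bounded_pos by fastforce
  have "M-lipschitz_on {t0..<Sup I} x"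
  proof (rule bounded_derivative_imp_lipschitz)
    fix t assume t: "t \<in> {t0..<Sup I}"
    then have "t \<in> I"
      using I_eq by blast
    then have "(x has_vector_derivative v t) (at t)"
      using v by (simp add: trajectory_def)
    then show "(x has_derivative (\<lambda>h. h *\<^sub>R v t)) (at t within {t0..<Sup I})"
      by (simp add: has_vector_derivative_def has_derivative_at_withinI)
    show "onorm (\<lambda>h. h *\<^sub>R v t) \<le> M"
      using mult_right_mono[OF M(1)[OF t]] by (intro onorm_le) (auto simp: mult.commute[of "\<bar>_\<bar>"])
  qed (use M in auto)
  then have bdx: "bounded (x ` {t0..<Sup I})"
    by (meson bounded_Ico bounded_uniformly_continuous_image lipschitz_on_uniformly_continuous)
  have bd': "bounded ((\<lambda>t. (x t, v t)) ` (I \<inter> {t0..}))"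
    unfolding I_eq using bounded_Times[OF bdx bd] by (rule bounded_subset) auto
  have z: "((\<lambda>t. (x t, v t)) has_vector_derivative F (x t, v t)) (at t)" if "t \<in> I" for t
    using v that unfolding trajectory_def F_def by (auto intro: has_vector_derivative_Pair)
  obtain J w where J: "open J" "is_interval J" "I \<subset> J"
    and w: "\<And>t. t \<in> I \<Longrightarrow> w t = (x t, v t)" "\<And>t. t \<in> J \<Longrightarrow> (w has_vector_derivative F (w t)) (at t)"
    using solution_continuation[OF F I' I t0 z bd'] by blast
  have "((\<lambda>t. fst (w t)) has_vector_derivative snd (w t)) (at t)"
    "((\<lambda>t. snd (w t)) has_vector_derivative acc (fst (w t)) (snd (w t))) (at t)" if "t \<in> J" for t
    using bounded_linear.has_vector_derivative[OF bounded_linear_fst w(2)[OF that]]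
      bounded_linear.has_vector_derivative[OF bounded_linear_snd w(2)[OF that]]
    by (simp_all add: F_def case_prod_beta)
  then have "trajectory acc J (\<lambda>t. fst (w t)) (\<lambda>t. snd (w t))"
    by (simp add: trajectory_def)
  then have "motion acc J (\<lambda>t. fst (w t))"
    unfolding motion_def using J t0 by blast
  moreover have "\<forall>t\<in>I. fst (w t) = x t"
    using w(1) by simp
  moreover have "I \<subseteq> J" "J \<noteq> I"
    using J(3) by auto
  ultimately show False
    using max unfolding maximal_motion_def by blast
qed

text \<open>The regularised inverse speed \<open>1 / sqrt (|v|\<^sup>2 + \<epsilon>\<^sup>2)\<close> is \<open>C\<close>-Lipschitz even at zeros of \<open>v\<close>.\<close>

lemma speed_blow_up:
  assumes v: "trajectory acc {t0..<b} x v" and unbd: "\<not> bounded (v ` {t0..<b})"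
    and t: "t \<in> {t0..<b}"
  shows "1 \<le> C * (b - t) * norm (v t)"
proof (rule field_le_epsilon)
  fix e :: real assume "e > 0"
  \<comment> \<open>Chosen so that the regularisation costs exactly \<open>e\<close> in the final
    inequality.\<close>
  define \<epsilon> where "\<epsilon> = e / (C * (b - t))"
  have \<epsilon>: "\<epsilon> > 0"
    using \<open>e > 0\<close> C_pos t by (simp add: \<epsilon>_def)
  define N where "N u = sqrt (v u \<bullet> v u + \<epsilon>\<^sup>2)" for u
  have N_pos: "N u > 0" for u
    using \<epsilon> by (simp add: N_def add_nonneg_pos)
  have N_ge: "norm (v u) \<le> N u" for u
    unfolding N_def norm_eq_sqrt_inner by simp
  have N_le: "N u \<le> norm (v u) + \<epsilon>" for u
    unfolding N_def using sqrt_add_le_add_sqrt[of "v u \<bullet> v u" "\<epsilon>\<^sup>2"] \<epsilon> by (simp add: norm_eq_sqrt_inner)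
  have der: "((\<lambda>u. inverse (N u)) has_real_derivative - (v u \<bullet> acc (x u) (v u)) / N u ^ 3) (at u)"
    if "u \<in> {t0..<b}" for u
  proof -
    have "((\<lambda>u. v u \<bullet> v u) has_real_derivative (v u \<bullet> acc (x u) (v u) + acc (x u) (v u) \<bullet> v u)) (at u)"
      using v that unfolding trajectory_def by (intro has_real_derivative_inner) auto
    then have "(N has_real_derivative (v u \<bullet> acc (x u) (v u)) / N u) (at u)"
      unfolding N_def using N_pos[of u] unfolding N_def
      by (auto intro!: derivative_eq_intros simp: inner_commute field_simps)
    then show ?thesis
      using N_pos[of u] by (auto intro!: derivative_eq_intros simp: field_simps power3_eq_cube)
  qed
  have der_le: "\<bar>- (v u \<bullet> acc (x u) (v u)) / N u ^ 3\<bar> \<le> C" for u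
  proof -
    have "\<bar>v u \<bullet> acc (x u) (v u)\<bar> \<le> norm (v u) * norm (acc (x u) (v u))"
      by (rule Cauchy_Schwarz_ineq2)
    also have "\<dots> \<le> norm (v u) * (C * (norm (v u))\<^sup>2)"
      by (intro mult_left_mono acc_bound) auto
    also have "\<dots> = C * norm (v u) ^ 3"
      by (simp add: power2_eq_square power3_eq_cube)
    also have "\<dots> \<le> C * N u ^ 3"
      using C_pos N_ge by (intro mult_left_mono power_mono) auto
    finally show ?thesis
      using N_pos[of u] by (simp add: field_simps)
  qed
  have slope: "inverse (N t) \<le> inverse (N u) + C * (b - t)" if "u \<in> {t..<b}" for u
  proof -
    have "norm (inverse (N t) - inverse (N u)) \<le> C * norm (t - u)"
    proof (rule field_differentiable_bound[of "{t..u}" "\<lambda>u. inverse (N u)"])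
      fix w assume "w \<in> {t..u}"
      then have "w \<in> {t0..<b}"
        using that t by auto
      then show "((\<lambda>u. inverse (N u)) has_field_derivative - (v w \<bullet> acc (x w) (v w)) / N w ^ 3) (at w within {t..u})"
        using der has_field_derivative_at_within by blast
      show "norm (- (v w \<bullet> acc (x w) (v w)) / N w ^ 3) \<le> C"
        using der_le by simp
    qed (use that in auto)
    also have "\<dots> \<le> C * (b - t)"
      using that C_pos by (intro mult_left_mono) auto
    finally show ?thesis
      by (simp add: real_norm_def)
  qed
  have "inverse (N t) \<le> C * (b - t)"
  proof (rule field_le_epsilon)
    fix d :: real assume d: "d > 0"
    \<comment> \<open>The velocity is bounded on the compact \<open>{t0..t}\<close>, so it is
      unbounded after \<open>t\<close>. Where the speed exceeds 1/d, the inverse of \<open>N\<close>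
      is below \<open>d\<close>, and \<open>slope\<close> carries this back to
      \<open>t\<close>.\<close>
    have "\<exists>u\<in>{t..<b}. norm (v u) > inverse d"
    proof (rule ccontr)
      assume "\<not> ?thesis"
      then have "bounded (v ` {t..<b})"
        unfolding bounded_iff by (intro exI[of _ "inverse d"]) force
      moreover have "compact (v ` {t0..t})"
        using trajectory_continuous_on(2)[OF v] t
        by (intro compact_continuous_image) (auto intro: continuous_on_subset)
      ultimately have "bounded (v ` {t0..t} \<union> v ` {t..<b})"
        by (simp add: compact_imp_bounded)
      then have "bounded (v ` {t0..<b})"
        by (rule bounded_subset) (unfold image_Un[symmetric], rule image_mono, auto)
      with unbd show False
        by blast
    qed
    then obtain u where u: "u \<in> {t..<b}" "norm (v u) > inverse d"
      by blast
    have "inverse (N u) < d"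
      using u(2) N_ge[of u] d N_pos[of u] by (smt (verit) inverse_inverse_eq inverse_less_imp_less positive_imp_inverse_positive)
    then show "inverse (N t) \<le> C * (b - t) + d"
      using slope[OF u(1)] by linarith
  qed
  then have "1 \<le> C * (b - t) * N t"
    using N_pos[of t] by (simp add: field_simps)
  also have "\<dots> \<le> C * (b - t) * (norm (v t) + \<epsilon>)"
    using N_le C_pos t by (intro mult_left_mono) auto
  also have "\<dots> = C * (b - t) * norm (v t) + e"
    using C_pos t by (simp add: \<epsilon>_def field_simps)
  finally show "1 \<le> C * (b - t) * norm (v t) + e" .
qed

text \<open>
  The quantity \<open>\<beta> = x \<bullet> v / |v|\<close> grows at least at half the speed and is at most \<open>|x|\<close>, so it
  serves as a lower bound for the radius that makes the decay of \<open>acc\<close> integrable; this is why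
  \<open>\<phi> = ln |v| + A (1 + \<beta>) powr (- \<mu>)\<close> is nonincreasing.
\<close>

lemma outgoing_bounded_velocity:
  assumes v: "trajectory acc {t0..<b} x v" and nz: "\<And>t. t \<in> {t0..<b} \<Longrightarrow> v t \<noteq> 0"
    and R: "C * (1 + R) powr (- \<mu>) \<le> 1/4" "R \<ge> 0" "norm (x t0) \<ge> R"
    and out: "x t0 \<bullet> v t0 > 0"
  shows "bounded (v ` {t0..<b})"
proof (cases "t0 < b")
  case t0b: True
  have x': "(x has_vector_derivative v t) (at t)" and v': "(v has_vector_derivative acc (x t) (v t)) (at t)"
    if "t \<in> {t0..<b}" for t
    using v that by (auto simp: trajectory_def)
  \<comment> \<open>Beyond radius \<open>R\<close> the acceleration is small compared with
    |v|^2/|x|. Hence (x \<bullet> v)' = |v|^2 + x \<bullet> acc is at least 3/4 |v|^2: the curve is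
    nearly straight.\<close>
  have far: "norm y * norm (acc y u) \<le> (norm u)\<^sup>2 / 4" if "norm y \<ge> R" for y u
  proof -
    have "norm y * norm (acc y u) \<le> (1 + norm y) * (C * (1 + norm y) powr (- 1 - \<mu>) * (norm u)\<^sup>2)"
      by (intro mult_mono decay) auto
    also have "\<dots> = C * ((1 + norm y) * (1 + norm y) powr (- 1 - \<mu>)) * (norm u)\<^sup>2"
      by (simp only: mult.commute mult.left_commute mult.assoc)
    also have "\<dots> = C * (1 + norm y) powr (- \<mu>) * (norm u)\<^sup>2"
      by (subst powr_mult_base) auto
    also have "\<dots> \<le> C * (1 + R) powr (- \<mu>) * (norm u)\<^sup>2"
      using that R(2) mu_pos C_pos by (intro mult_right_mono mult_left_mono powr_mono2') auto
    also have "\<dots> \<le> 1/4 * (norm u)\<^sup>2"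
      using R(1) by (intro mult_right_mono) auto
    finally show ?thesis
      by simp
  qed
  define m where "m t = x t \<bullet> v t" for t
  have m': "(m has_real_derivative (x t \<bullet> acc (x t) (v t) + v t \<bullet> v t)) (at t)" if "t \<in> {t0..<b}" for t
    unfolding m_def using x' v' that by (intro has_real_derivative_inner)
  have m'_nonneg: "x t \<bullet> acc (x t) (v t) + v t \<bullet> v t \<ge> 0" if "norm (x t) \<ge> R" for t
    using far[OF that, of "v t"] Cauchy_Schwarz_ineq2[of "x t" "acc (x t) (v t)"]
    by (simp add: power2_norm_eq_inner)
  have stays_far: "norm (x t) \<ge> R" if "t \<in> {t0..<b}" "\<And>u. t0 < u \<Longrightarrow> u < t \<Longrightarrow> m u > 0" for t
  proof -
    have "x t0 \<bullet> x t0 \<le> x t \<bullet> x t"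
    proof (rule DERIV_nonneg_imp_increasing_open[where f = "\<lambda>u. x u \<bullet> x u"])
      fix u assume u: "t0 < u" "u < t"
      then have "((\<lambda>u. x u \<bullet> x u) has_real_derivative (x u \<bullet> v u + v u \<bullet> x u)) (at u)"
        using that(1) by (intro has_real_derivative_inner x') auto
      then show "\<exists>y. ((\<lambda>u. x u \<bullet> x u) has_real_derivative y) (at u) \<and> 0 \<le> y"
        using that(2)[OF u] by (intro exI conjI) (auto simp: m_def inner_commute)
    next
      show "continuous_on {t0..t} (\<lambda>u. x u \<bullet> x u)"
        using that(1) by (intro continuous_intros continuous_on_subset[OF trajectory_continuous_on(1)[OF v]]) auto
    qed (use that in auto)
    then have "norm (x t0) \<le> norm (x t)"
      by (simp add: norm_le)
    then show ?thesis
      using R(3) by simp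
  qed
  have m_cont: "continuous_on {t0..<b} m"
    unfolding m_def using trajectory_continuous_on[OF v] by (intro continuous_intros)
  \<comment> \<open>Positivity of \<open>m\<close> keeps the curve far out, and being far out keeps
    \<open>m\<close> from decreasing. The circle is broken at the first time \<open>c\<close> with
    \<open>m c \<le> 0\<close>, before which both hold; then \<open>m t0 \<le> m c\<close> is
    absurd.\<close>
  have m_pos: "m t > 0" if t: "t \<in> {t0..<b}" for t
  proof (rule ccontr)
    assume neg: "\<not> m t > 0"
    define S where "S = {u \<in> {t0..t}. m u \<le> 0}"
    have "closed S"
      unfolding S_def using t
      by (intro continuous_on_closed_Collect_le continuous_intros continuous_on_subset[OF m_cont]) auto
    moreover have "S \<noteq> {}" "bdd_below S"
      using t neg by (auto simp: S_def intro!: bdd_belowI[of _ t0])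
    ultimately have inf: "Inf S \<in> S"
      using closed_contains_Inf by blast
    define c where "c = Inf S"
    have c: "c \<in> {t0..t}" "m c \<le> 0"
      using inf by (auto simp: S_def c_def)
    have pos: "m u > 0" if "t0 < u" "u < c" for u
    proof (rule ccontr)
      assume "\<not> m u > 0"
      then have "u \<in> S"
        using that c by (auto simp: S_def)
      then have "c \<le> u"
        unfolding c_def using \<open>bdd_below S\<close> cInf_lower by blast
      with that show False
        by simp
    qed
    have "m t0 \<le> m c"
    proof (rule DERIV_nonneg_imp_increasing_open[where f = m])
      fix u assume u: "t0 < u" "u < c"
      then have "norm (x u) \<ge> R"
        using c t pos by (intro stays_far) auto
      then show "\<exists>y. (m has_real_derivative y) (at u) \<and> 0 \<le> y"
        using m'[of u] m'_nonneg[of u] u c t by auto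
    next
      show "continuous_on {t0..c} m"
        using c t by (intro continuous_on_subset[OF m_cont]) auto
    qed (use c in auto)
    then show False
      using c(2) out by (simp add: m_def)
  qed
  have R_le: "norm (x t) \<ge> R" if "t \<in> {t0..<b}" for t
    using that m_pos by (intro stays_far) auto
  \<comment> \<open>With \<beta>' \<ge> |v|/2, the derivative of A (1 + \<beta>)^(-\<mu>) is at most
    -(A \<mu>/2) (1 + \<beta>)^(-1-\<mu>) |v|. The choice A \<mu> = 2 C cancels the bound C (1 +
    \<beta>)^(-1-\<mu>) |v| for the derivative of ln |v|.\<close>
  define A where "A = 2 * C / \<mu>"
  define \<beta> where "\<beta> t = m t / norm (v t)" for t
  define \<phi> where "\<phi> t = ln (norm (v t)) + A * (1 + \<beta> t) powr (- \<mu>)" for t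
  have A: "A \<ge> 0" "A * \<mu> = 2 * C"
    using C_pos mu_pos by (auto simp: A_def)
  have \<beta>_pos: "\<beta> t > 0" if "t \<in> {t0..<b}" for t
    using m_pos[OF that] nz[OF that] by (simp add: \<beta>_def)
  have \<beta>_le: "\<beta> t \<le> norm (x t)" if "t \<in> {t0..<b}" for t
    using nz[OF that] norm_cauchy_schwarz[of "x t" "v t"] by (simp add: \<beta>_def m_def field_simps)
  have \<phi>': "\<exists>y. (\<phi> has_real_derivative y) (at t) \<and> y \<le> 0" if t: "t \<in> {t0..<b}" for t
  proof -
    define a where "a = acc (x t) (v t)"
    define n where "n = norm (v t)"
    have n: "n > 0"
      using nz[OF t] by (simp add: n_def)
    have nd: "((\<lambda>t. norm (v t)) has_real_derivative (v t \<bullet> a / n)) (at t)"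
      unfolding a_def n_def using v'[OF t] nz[OF t] by (rule has_real_derivative_norm)
    define \<beta>' where "\<beta>' = ((x t \<bullet> a + v t \<bullet> v t) * n - m t * (v t \<bullet> a / n)) / n\<^sup>2"
    have \<beta>d: "(\<beta> has_real_derivative \<beta>') (at t)"
      unfolding \<beta>_def \<beta>'_def using m'[OF t] nd n
      by (auto intro!: derivative_eq_intros simp: n_def a_def power2_eq_square)
    have \<phi>d: "(\<phi> has_real_derivative (v t \<bullet> a / n) / n + A * ((- \<mu>) * (1 + \<beta> t) powr (- \<mu> - 1) * \<beta>')) (at t)"
      unfolding \<phi>_def using \<beta>d nd n \<beta>_pos[OF t]
      by (auto intro!: derivative_eq_intros simp: n_def powr_diff field_simps)
    have xa: "norm (x t) * norm a \<le> n\<^sup>2 / 4"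
      unfolding a_def n_def by (rule far[OF R_le[OF t]])
    have va: "\<bar>v t \<bullet> a\<bar> \<le> n * norm a"
      unfolding n_def by (rule Cauchy_Schwarz_ineq2)
    \<comment> \<open>In the numerator of \<open>\<beta>'\<close> the terms with \<open>a\<close>
      cost at most \<open>norm (x t) * norm a\<close> each, after a factor \<open>n\<close>. By
      \<open>xa\<close> that is at most n^2/4 twice, which leaves half of the main term n^3.\<close>
    have "m t * (v t \<bullet> a / n) \<le> (norm (x t) * n) * norm a"
    proof -
      have "v t \<bullet> a / n \<le> norm a"
        using va n by (simp add: pos_divide_le_eq mult.commute)
      then have "m t * (v t \<bullet> a / n) \<le> m t * norm a"
        using m_pos[OF t] by (intro mult_left_mono) auto
      also have "\<dots> \<le> (norm (x t) * n) * norm a"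
        unfolding m_def n_def by (intro mult_right_mono norm_cauchy_schwarz) auto
      finally show ?thesis .
    qed
    moreover have "x t \<bullet> a \<ge> - (norm (x t) * norm a)"
      using Cauchy_Schwarz_ineq2[of "x t" a] by simp
    then have "(x t \<bullet> a + v t \<bullet> v t) * n \<ge> (n\<^sup>2 - norm (x t) * norm a) * n"
      using n by (intro mult_right_mono) (auto simp: n_def power2_norm_eq_inner)
    ultimately have "(x t \<bullet> a + v t \<bullet> v t) * n - m t * (v t \<bullet> a / n) \<ge> (n\<^sup>2 - 2 * (norm (x t) * norm a)) * n"
      by (simp add: algebra_simps)
    moreover have "(n\<^sup>2 - 2 * (norm (x t) * norm a)) * n \<ge> (n\<^sup>2 / 2) * n"
      using xa n by (intro mult_right_mono) auto
    ultimately have "(x t \<bullet> a + v t \<bullet> v t) * n - m t * (v t \<bullet> a / n) \<ge> (n\<^sup>2 / 2) * n"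
      by linarith
    then have \<beta>'_ge: "\<beta>' \<ge> n / 2"
      unfolding \<beta>'_def using n by (simp add: field_simps power2_eq_square)
    have "v t \<bullet> a / n / n \<le> n * norm a / n / n"
      using va n by (intro divide_right_mono) auto
    also have "\<dots> = norm a / n"
      using n by simp
    also have "\<dots> \<le> C * (1 + norm (x t)) powr (- 1 - \<mu>) * n\<^sup>2 / n"
      using decay[of "x t" "v t"] n by (intro divide_right_mono) (auto simp: a_def n_def)
    also have "\<dots> = C * (1 + norm (x t)) powr (- 1 - \<mu>) * n"
      using n by (simp add: power2_eq_square)
    also have "\<dots> \<le> C * (1 + \<beta> t) powr (- 1 - \<mu>) * n"
      using \<beta>_pos[OF t] \<beta>_le[OF t] C_pos mu_pos n
      by (intro mult_right_mono mult_left_mono powr_mono2') auto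
    also have "\<dots> = A * (\<mu> * (1 + \<beta> t) powr (- \<mu> - 1) * (n / 2))"
    proof -
      have "A * (\<mu> * (1 + \<beta> t) powr (- \<mu> - 1) * (n / 2)) = (A * \<mu>) * ((1 + \<beta> t) powr (- \<mu> - 1) * (n / 2))"
        by simp
      also have "\<dots> = C * (1 + \<beta> t) powr (- 1 - \<mu>) * n"
        unfolding A(2) by (simp add: minus_diff_commute[of \<mu> 1])
      finally show ?thesis
        by (rule sym)
    qed
    also have "\<dots> \<le> A * (\<mu> * (1 + \<beta> t) powr (- \<mu> - 1) * \<beta>')"
      using A(1) mu_pos \<beta>'_ge by (intro mult_left_mono) auto
    finally have "v t \<bullet> a / n / n + A * ((- \<mu>) * (1 + \<beta> t) powr (- \<mu> - 1) * \<beta>') \<le> 0"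
      by simp
    with \<phi>d show ?thesis
      by blast
  qed
  have "norm (v t) \<le> exp (\<phi> t0)" if t: "t \<in> {t0..<b}" for t
  proof -
    have "\<phi> t \<le> \<phi> t0"
      by (rule DERIV_nonpos_imp_nonincreasing) (use t \<phi>' in auto)
    moreover have "ln (norm (v t)) \<le> \<phi> t"
      using A by (simp add: \<phi>_def)
    ultimately show ?thesis
      using nz[OF t] by (metis exp_le_cancel_iff exp_ln order_trans zero_less_norm_iff)
  qed
  then show ?thesis
    by (intro boundedI[of _ "exp (\<phi> t0)"]) auto
qed simp

text \<open>Outside radius \<open>R\<close> the derivative 2 (x \<bullet> v) of |x|^2 is at most 0.
  Were the bound \<open>K\<close> exceeded at \<open>t\<close>, then |x|^2 would not increase from
  the last time \<open>c\<close> with norm at most \<open>K\<close> up to \<open>t\<close>.\<close>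

lemma incoming_bounded_position:
  assumes v: "trajectory acc {t0..<b} x v"
    and inc: "\<And>t. t \<in> {t0..<b} \<Longrightarrow> norm (x t) \<ge> R \<Longrightarrow> x t \<bullet> v t \<le> 0" and t: "t \<in> {t0..<b}"
  shows "norm (x t) \<le> max R (norm (x t0))"
proof (rule ccontr)
  assume far: "\<not> ?thesis"
  define K where "K = max R (norm (x t0))"
  have x: "continuous_on {t0..t} x"
    using t by (intro continuous_on_subset[OF trajectory_continuous_on(1)[OF v]]) auto
  define S where "S = {u \<in> {t0..t}. norm (x u) \<le> K}"
  have "closed S"
    unfolding S_def using x by (intro continuous_on_closed_Collect_le continuous_intros)
  moreover have "S \<noteq> {}" "bdd_above S"
    using t by (auto simp: S_def K_def intro!: bdd_aboveI[of _ t])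
  ultimately have sup: "Sup S \<in> S"
    using closed_contains_Sup by blast
  define c where "c = Sup S"
  have c: "c \<in> {t0..t}" "norm (x c) \<le> K"
    using sup by (auto simp: S_def c_def)
  have gt: "norm (x u) > K" if "c < u" "u \<le> t" for u
  proof (rule ccontr)
    assume "\<not> norm (x u) > K"
    then have "u \<in> S"
      using that c by (auto simp: S_def)
    then have "u \<le> c"
      unfolding c_def using \<open>bdd_above S\<close> cSup_upper by blast
    with that show False
      by simp
  qed
  have "x t \<bullet> x t \<le> x c \<bullet> x c"
  proof (rule DERIV_nonpos_imp_decreasing_open[where f = "\<lambda>u. x u \<bullet> x u"])
    fix u assume u: "c < u" "u < t"
    then have "((\<lambda>u. x u \<bullet> x u) has_real_derivative (x u \<bullet> v u + v u \<bullet> x u)) (at u)"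
      using v t c by (intro has_real_derivative_inner) (auto simp: trajectory_def)
    moreover have "x u \<bullet> v u \<le> 0"
      using gt[of u] u t c by (intro inc) (auto simp: K_def)
    ultimately show "\<exists>y. ((\<lambda>u. x u \<bullet> x u) has_real_derivative y) (at u) \<and> y \<le> 0"
      by (intro exI[of _ "x u \<bullet> v u + v u \<bullet> x u"]) (simp add: inner_commute)
  next
    show "continuous_on {c..t} (\<lambda>u. x u \<bullet> x u)"
      using c by (intro continuous_intros continuous_on_subset[OF x]) auto
  qed (use c in auto)
  then show False
    using far c(2) by (simp add: K_def flip: norm_le)
qed

section \<open>The limit at unit speed and its affine parametrisation\<close>

text \<open>The equation for \<open>W\<close> is that of a geodesic in Euclidean arclength: the
  tangential part of the acceleration is removed. The bound \<open>blow\<close> gives the orbit all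
  positive arclengths, and homogeneity turns the constant \<kappa> into \<kappa>/|v|^2, which tends
  to 0; both conclusions survive in an omega-limit.\<close>

lemma unit_speed_limit:
  fixes Q :: "'a \<Rightarrow> 'a \<Rightarrow> real"
  assumes v: "trajectory acc {t0..<b} x v" and t0b: "t0 < b"
    and blow: "\<And>t. t \<in> {t0..<b} \<Longrightarrow> 1 \<le> C * (b - t) * norm (v t)"
    and K: "\<And>t. t \<in> {t0..<b} \<Longrightarrow> norm (x t) \<le> K"
    and Q_cont: "\<And>p. isCont (\<lambda>(x, v). Q x v) p"
    and Q_hom: "\<And>x c v. Q x (c *\<^sub>R v) = c\<^sup>2 * Q x v"
    and Q_const: "\<And>t. t \<in> {t0..<b} \<Longrightarrow> Q (x t) (v t) = \<kappa>"
  obtains Y W where "\<And>s. (Y has_vector_derivative W s) (at s)"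
    "\<And>s. (W has_vector_derivative (acc (Y s) (W s) - (W s \<bullet> acc (Y s) (W s)) *\<^sub>R W s)) (at s)"
    "\<And>s. norm (W s) = 1" "\<And>s. norm (Y s) \<le> K" "\<And>s. Q (Y s) (W s) = 0"
proof -
  define J where "J = {t0<..<b}"
  define c where "c = (t0 + b) / 2"
  have c: "c \<in> J" and J_sub: "J \<subseteq> {t0..<b}" and J: "open J" "is_interval J"
    using t0b by (auto simp: J_def c_def is_interval_1)
  have v_pos: "norm (v t) > 0" if "t \<in> J" for t
    using blow[of t] that J_sub by (cases "v t = 0") auto
  have x': "(x has_vector_derivative v t) (at t)" and v': "(v has_vector_derivative acc (x t) (v t)) (at t)"
    if "t \<in> J" for t
    using v that J_sub by (auto simp: trajectory_def)
  have "continuous_on J (\<lambda>t. norm (v t))"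
    using trajectory_continuous_on(2)[OF v] J_sub by (intro continuous_intros) (rule continuous_on_subset)
  then obtain s where s_c: "s c = 0" and s': "\<And>t. t \<in> J \<Longrightarrow> (s has_real_derivative norm (v t)) (at t)"
    using antiderivative_open_interval[OF J c] by blast
  note inv = inv_into_of_increasing[OF J s' v_pos]
  define h where "h = inv_into J s"
  have sJ: "is_interval (s ` J)"
    using inv(2) by simp
  have h: "h u \<in> J \<and> s (h u) = u \<and> (h has_real_derivative inverse (norm (v (h u)))) (at u)"
    if "u \<in> s ` J" for u
    using inv(4)[of "h u"] that unfolding h_def by (simp add: inv_into_into f_inv_into_f)
  have s_mono: "s t \<le> s u" if "t \<in> J" "u \<in> J" "t \<le> u" for t u
  proof (rule DERIV_nonneg_imp_nondecreasing[OF \<open>t \<le> u\<close>])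
    fix r assume "t \<le> r" "r \<le> u"
    then have "r \<in> J"
      using that by (auto simp: J_def)
    then show "\<exists>y. (s has_real_derivative y) (at r) \<and> 0 \<le> y"
      using s' norm_ge_zero by blast
  qed
  have pos_image: "u \<in> s ` J" if "u > 0" for u
  proof -
    \<comment> \<open>Solves ln((b - c)/(b - t)) / C = u. As s' = |v| is at least 1/(C (b - r)), the
      arclength from \<open>c\<close> to this \<open>t\<close> is at least \<open>u\<close>.\<close>
    define t where "t = b - (b - c) * exp (- C * u)"
    have bc: "b - c > 0"
      using c by (simp add: J_def)
    have "exp (- C * u) \<le> 1"
      using C_pos that by simp
    then have "(b - c) * exp (- C * u) \<le> b - c"
      using bc mult_left_mono[of "exp (- C * u)" 1 "b - c"] by simp
    moreover have "(b - c) * exp (- C * u) > 0"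
      using bc by simp
    ultimately have t: "c \<le> t" "t < b"
      unfolding t_def by linarith+
    define \<psi> where "\<psi> r = s r + ln (b - r) / C" for r
    have "\<psi> c \<le> \<psi> t"
    proof (rule DERIV_nonneg_imp_nondecreasing[OF t(1)])
      fix r assume "c \<le> r" "r \<le> t"
      then have r: "r \<in> J" "r < b"
        using c t by (auto simp: J_def)
      have "(\<psi> has_real_derivative (norm (v r) - 1 / (C * (b - r)))) (at r)"
        unfolding \<psi>_def using s'[OF r(1)] r(2) C_pos
        by (auto intro!: derivative_eq_intros simp: field_simps)
      moreover have "norm (v r) - 1 / (C * (b - r)) \<ge> 0"
        using blow[of r] r J_sub C_pos by (auto simp: field_simps)
      ultimately show "\<exists>y. (\<psi> has_real_derivative y) (at r) \<and> 0 \<le> y"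
        by blast
    qed
    moreover have "ln (b - t) = ln (b - c) - C * u"
      using bc by (simp add: t_def ln_mult)
    ultimately have "u \<le> s t"
      using s_c C_pos by (simp add: \<psi>_def diff_divide_distrib)
    moreover have "t \<in> J"
      using t c by (auto simp: J_def)
    ultimately show ?thesis
      using sJ c s_c that unfolding is_interval_1 by (metis imageI less_imp_le)
  qed
  define \<omega> where "\<omega> t = inverse (norm (v t)) *\<^sub>R v t" for t
  define z where "z u = (x (h u), \<omega> (h u))" for u
  \<comment> \<open>The unit-speed flow on pairs (position, direction). It is autonomous and as
    regular as \<open>acc\<close>, so \<open>omega_limit_solution\<close> applies to it.\<close>
  define F where "F = (\<lambda>(y, w). (w, acc y w - (w \<bullet> acc y w) *\<^sub>R w))"
  have fst_snd: "lipschitz_on_balls (fst :: 'a \<times> 'a \<Rightarrow> 'a)" "lipschitz_on_balls (snd :: 'a \<times> 'a \<Rightarrow> 'a)"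
    by (auto intro: bounded_linear_lipschitz_on_balls bounded_linear_fst bounded_linear_snd)
  have F: "lipschitz_on_balls F"
    unfolding F_def case_prod_beta'
    by (intro lipschitz_on_balls_Pair lipschitz_on_balls_diff lipschitz_on_balls_scaleR
        lipschitz_on_balls_inner fst_snd lipschitz[unfolded case_prod_beta'])
  have z': "(z has_vector_derivative F (z u)) (at u)" if "u > 0" for u
  proof -
    define t where "t = h u"
    define n where "n = norm (v t)"
    define a where "a = acc (x t) (v t)"
    have t: "t \<in> J" and h': "(h has_vector_derivative inverse n) (at u)"
      using h[OF pos_image[OF that]] by (auto simp: t_def n_def has_real_derivative_iff_has_vector_derivative)
    have n: "n > 0"
      using v_pos[OF t] by (simp add: n_def)
    have "((x \<circ> h) has_vector_derivative inverse n *\<^sub>R v t) (at u)"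
      using vector_diff_chain_at[OF h'] x'[OF t] by (simp add: t_def)
    then have 1: "((\<lambda>u. x (h u)) has_vector_derivative \<omega> t) (at u)"
      by (simp add: \<omega>_def n_def o_def)
    have "((\<lambda>t. norm (v t)) has_real_derivative (v t \<bullet> a / n)) (at t)"
      unfolding a_def n_def using v'[OF t] v_pos[OF t] by (intro has_real_derivative_norm) auto
    then have "((\<lambda>t. inverse (norm (v t))) has_real_derivative (- (v t \<bullet> a) / n ^ 3)) (at t)"
      using n by (auto intro!: derivative_eq_intros simp: n_def field_simps power3_eq_cube)
    then have "(\<omega> has_vector_derivative (inverse n *\<^sub>R a + (- (v t \<bullet> a) / n ^ 3) *\<^sub>R v t)) (at t)"
      unfolding \<omega>_def a_def n_def by (intro has_vector_derivative_scaleR v' t)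
    then have "((\<omega> \<circ> h) has_vector_derivative
        inverse n *\<^sub>R (inverse n *\<^sub>R a + (- (v t \<bullet> a) / n ^ 3) *\<^sub>R v t)) (at u)"
      using vector_diff_chain_at[OF h'] by (simp add: t_def)
    \<comment> \<open>By \<open>quadratic\<close>, dividing the acceleration by n^2 means evaluating
      it at the unit vector; the term with n^3, from differentiating 1/n, is the tangential
      part.\<close>
    moreover have "inverse n *\<^sub>R (inverse n *\<^sub>R a + (- (v t \<bullet> a) / n ^ 3) *\<^sub>R v t)
        = acc (x t) (\<omega> t) - (\<omega> t \<bullet> acc (x t) (\<omega> t)) *\<^sub>R \<omega> t"
    proof -
      have "acc (x t) (\<omega> t) = (inverse n)\<^sup>2 *\<^sub>R a"
        unfolding \<omega>_def quadratic n_def a_def ..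
      then show ?thesis
        using n by (simp add: \<omega>_def n_def[symmetric] scaleR_add_right power2_eq_square power3_eq_cube field_simps)
    qed
    ultimately have 2: "((\<lambda>u. \<omega> (h u)) has_vector_derivative
        acc (x t) (\<omega> t) - (\<omega> t \<bullet> acc (x t) (\<omega> t)) *\<^sub>R \<omega> t) (at u)"
      by (simp add: o_def)
    show ?thesis
      using has_vector_derivative_Pair[OF 1 2] by (simp add: z_def[abs_def] F_def t_def)
  qed
  have z_in: "norm (fst (z u)) \<le> K \<and> norm (snd (z u)) = 1" if "u > 0" for u
    using h[OF pos_image[OF that]] K[of "h u"] v_pos[of "h u"] J_sub by (auto simp: z_def \<omega>_def)
  have "bounded (cball 0 K \<times> cball 0 1 :: ('a \<times> 'a) set)"
    by (intro bounded_Times bounded_cball)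
  moreover have "z u \<in> cball 0 K \<times> cball 0 1" if "u \<in> {0<..}" for u
    using z_in[of u] that by (simp add: mem_Times_iff)
  then have "z ` {0<..} \<subseteq> cball 0 K \<times> cball 0 1"
    by (rule image_subsetI)
  ultimately have bd: "bounded (z ` {0<..})"
    by (rule bounded_subset)
  obtain w \<sigma> where \<sigma>: "filterlim \<sigma> at_top sequentially"
    and w: "\<And>t. (\<lambda>n::nat. z (\<sigma> n + t)) \<longlonglongrightarrow> w t"
    and w': "\<And>t. (w has_vector_derivative F (w t)) (at t)"
    by (rule omega_limit_solution[OF F _ bd]) (rule z', assumption, rule that)
  have \<sigma>_t: "filterlim (\<lambda>n. \<sigma> n + t) at_top sequentially" for t
    using filterlim_tendsto_add_at_top[OF tendsto_const[of t] \<sigma>] by (simp add: add.commute)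
  have ev_pos: "\<forall>\<^sub>F n in sequentially. \<sigma> n + t > 0" for t
    using \<sigma>_t[of t] unfolding filterlim_at_top_dense by blast
  \<comment> \<open>Normalising the velocity divides the conserved value by |v|^2, which
    \<open>blow\<close> bounds below by 1/(C (b - h u))^2; as arclength grows, \<open>h u\<close>
    tends to \<open>b\<close>.\<close>
  have Q_bound: "norm (Q (fst (z u)) (snd (z u))) \<le> \<bar>\<kappa>\<bar> * (C * (b - h u))\<^sup>2" if "u > 0" for u
  proof -
    have hu: "h u \<in> {t0..<b}" and n: "norm (v (h u)) > 0"
      using h[OF pos_image[OF that]] J_sub v_pos by auto
    have "inverse (norm (v (h u))) \<le> C * (b - h u)"
      using blow[OF hu] n by (simp add: field_simps)
    then have "(inverse (norm (v (h u))))\<^sup>2 \<le> (C * (b - h u))\<^sup>2"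
      using n by (intro power_mono) auto
    moreover have "Q (fst (z u)) (snd (z u)) = (inverse (norm (v (h u))))\<^sup>2 * \<kappa>"
      using Q_const[OF hu] by (simp add: z_def \<omega>_def Q_hom)
    ultimately show ?thesis
      by (simp add: abs_mult mult.commute mult_left_mono)
  qed
  have "((\<lambda>u. b - h u) \<longlongrightarrow> 0) at_top"
  proof (rule tendstoI)
    fix e :: real assume "e > 0"
    define t where "t = max c (b - e / 2)"
    have t: "t \<in> J" "b - t < e"
      using c \<open>e > 0\<close> by (auto simp: t_def J_def)
    have "dist (b - h u) 0 < e" if "u > max 0 (s t)" for u
    proof -
      have hu: "h u \<in> J" "s (h u) = u"
        using h[OF pos_image, of u] that by auto
      then have "t < h u"
        using s_mono[OF hu(1) t(1)] that by force
      then show ?thesis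
        using t hu(1) by (simp add: J_def dist_real_def)
    qed
    then show "\<forall>\<^sub>F u in at_top. dist (b - h u) 0 < e"
      using eventually_gt_at_top[of "max 0 (s t)"] by (rule eventually_mono[rotated])
  qed
  then have h_lim: "(\<lambda>n. \<bar>\<kappa>\<bar> * (C * (b - h (\<sigma> n + t)))\<^sup>2) \<longlonglongrightarrow> \<bar>\<kappa>\<bar> * (C * 0)\<^sup>2" for t
    by (intro tendsto_intros filterlim_compose[OF _ \<sigma>_t])
  show ?thesis
  proof (rule that[of "\<lambda>t. fst (w t)" "\<lambda>t. snd (w t)"])
    fix t
    show "((\<lambda>t. fst (w t)) has_vector_derivative snd (w t)) (at t)"
      "((\<lambda>t. snd (w t)) has_vector_derivative
        acc (fst (w t)) (snd (w t)) - (snd (w t) \<bullet> acc (fst (w t)) (snd (w t))) *\<^sub>R snd (w t)) (at t)"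
      using bounded_linear.has_vector_derivative[OF bounded_linear_fst w'[of t]]
        bounded_linear.has_vector_derivative[OF bounded_linear_snd w'[of t]]
      by (simp_all add: F_def case_prod_beta)
    have "(\<lambda>n. norm (snd (z (\<sigma> n + t)))) \<longlonglongrightarrow> norm (snd (w t))"
      by (intro tendsto_intros w)
    moreover have "(\<lambda>n. norm (snd (z (\<sigma> n + t)))) \<longlonglongrightarrow> 1"
      by (rule tendsto_eventually, rule eventually_mono[OF ev_pos[of t]]) (use z_in in simp)
    ultimately show "norm (snd (w t)) = 1"
      using LIMSEQ_unique by blast
    show "norm (fst (w t)) \<le> K"
      by (rule tendsto_upperbound[OF tendsto_norm[OF tendsto_fst[OF w]]],
          rule eventually_mono[OF ev_pos[of t]]) (use z_in in auto)
    have "(\<lambda>n. Q (fst (z (\<sigma> n + t))) (snd (z (\<sigma> n + t)))) \<longlonglongrightarrow> Q (fst (w t)) (snd (w t))"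
      using isCont_tendsto_compose[OF Q_cont w] by (simp add: case_prod_beta)
    moreover have "(\<lambda>n. Q (fst (z (\<sigma> n + t))) (snd (z (\<sigma> n + t)))) \<longlonglongrightarrow> 0"
      by (rule Lim_null_comparison[OF _ h_lim[of t, simplified]],
          rule eventually_mono[OF ev_pos[of t]]) (use Q_bound in simp)
    ultimately show "Q (fst (w t)) (snd (w t)) = 0"
      using LIMSEQ_unique by blast
  qed
qed

text \<open>Integrating factor: in s, the derivative of \<rho> W is \<rho> acc + (\<rho>' - \<rho>
  q) W with q = W \<bullet> acc, so \<rho> = exp P with P' = q removes the tangential term. With
  dt/ds = 1/\<rho> the velocity is \<rho> W and its t-derivative is \<rho>^2 acc(Y, W), which is the
  acceleration at \<rho> W.\<close>

lemma affine_reparametrization: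
  assumes Y: "\<And>s. (Y has_vector_derivative W s) (at s)"
    and W: "\<And>s. (W has_vector_derivative (acc (Y s) (W s) - (W s \<bullet> acc (Y s) (W s)) *\<^sub>R W s)) (at s)"
    and W1: "\<And>s. norm (W s) = 1"
  obtains J y w where "maximal_motion acc J y" "trajectory acc J y w"
    "\<And>t. t \<in> J \<Longrightarrow> \<exists>s r. r > 0 \<and> y t = Y s \<and> w t = r *\<^sub>R W s"
proof -
  define q where "q s = W s \<bullet> acc (Y s) (W s)" for s
  have contY: "continuous_on UNIV Y" and contW: "continuous_on UNIV W"
    using Y W by (meson continuous_at_imp_continuous_on has_vector_derivative_continuous)+
  have "continuous_on UNIV (\<lambda>s. acc (Y s) (W s))"
    using continuous_on_compose2[OF lipschitz_on_balls_continuous_on[OF lipschitz, of UNIV]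
        continuous_on_Pair[OF contY contW]] by simp
  then have "continuous_on UNIV q"
    unfolding q_def using contW by (intro continuous_intros)
  then obtain P where P: "\<And>s. (P has_real_derivative q s) (at s)"
    using antiderivative_open_interval[of UNIV 0 q] by auto
  have "continuous_on UNIV (\<lambda>s. exp (- P s))"
    using P by (intro continuous_intros continuous_at_imp_continuous_on) (blast intro: DERIV_isCont)
  \<comment> \<open>The affine parameter as a function of arclength, with derivative 1/\<rho>; its
    range \<open>J\<close> may well be bounded.\<close>
  then obtain T where T0: "T 0 = 0" and T: "\<And>s. (T has_real_derivative exp (- P s)) (at s)"
    using antiderivative_open_interval[of UNIV 0] by auto
  define J where "J = range T"
  note inv = inv_into_of_increasing[of UNIV T "\<lambda>s. exp (- P s)", OF open_UNIV is_interval_univ T exp_gt_zero]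
  have J: "open J" "is_interval J"
    using inv(1,2) by (simp_all add: J_def)
  define h where "h = inv T"
  have hT: "h (T s) = s" for s
    using inv(3) by (simp add: h_def)
  have h: "(h has_real_derivative inverse (exp (- P (h t)))) (at t)" if "t \<in> J" for t
    using that inv(4) hT unfolding J_def h_def by auto
  define \<rho> where "\<rho> s = exp (P s)" for s
  have h': "(h has_real_derivative \<rho> (h t)) (at t)" if "t \<in> J" for t
    using h[OF that] by (simp add: \<rho>_def exp_minus)
  have T_less: "T s < T u" if "s < u" for s u
    by (rule DERIV_pos_imp_increasing[OF that]) (use T exp_gt_zero in blast)
  define y w where "y t = Y (h t)" and "w t = \<rho> (h t) *\<^sub>R W (h t)" for t
  have norm_w: "norm (w t) = \<rho> (h t)" for t
    by (simp add: w_def W1 \<rho>_def)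
  have traj: "trajectory acc J y w"
    unfolding trajectory_def
  proof safe
    fix t assume t: "t \<in> J"
    define s where "s = h t"
    have h'': "(h has_vector_derivative \<rho> s) (at t)"
      using h'[OF t] by (simp add: s_def has_real_derivative_iff_has_vector_derivative)
    show "(y has_vector_derivative w t) (at t)"
      using vector_diff_chain_at[OF h''[unfolded s_def] Y] by (simp add: y_def[abs_def] w_def o_def)
    have "(\<rho> has_real_derivative (\<rho> s * q s)) (at s)"
      unfolding \<rho>_def using P[of s] by (auto intro!: derivative_eq_intros)
    then have "((\<lambda>s. \<rho> s *\<^sub>R W s) has_vector_derivative
        (\<rho> s *\<^sub>R (acc (Y s) (W s) - q s *\<^sub>R W s) + (\<rho> s * q s) *\<^sub>R W s)) (at s)"
      using W[of s] unfolding q_def by (rule has_vector_derivative_scaleR)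
    moreover have "\<rho> s *\<^sub>R (acc (Y s) (W s) - q s *\<^sub>R W s) + (\<rho> s * q s) *\<^sub>R W s = \<rho> s *\<^sub>R acc (Y s) (W s)"
      by (simp add: algebra_simps)
    ultimately have "((\<lambda>s. \<rho> s *\<^sub>R W s) has_vector_derivative \<rho> s *\<^sub>R acc (Y s) (W s)) (at s)"
      by simp
    then have "(((\<lambda>s. \<rho> s *\<^sub>R W s) \<circ> h) has_vector_derivative \<rho> s *\<^sub>R \<rho> s *\<^sub>R acc (Y s) (W s)) (at t)"
      unfolding s_def by (intro vector_diff_chain_at h''[unfolded s_def])
    moreover have "\<rho> s *\<^sub>R \<rho> s *\<^sub>R acc (Y s) (W s) = acc (y t) (w t)"
      by (simp add: y_def w_def s_def quadratic power2_eq_square)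
    ultimately show "(w has_vector_derivative acc (y t) (w t)) (at t)"
      by (simp add: w_def[abs_def] o_def)
  qed
  \<comment> \<open>The speed of \<open>y\<close> is \<open>\<rho>\<close>, so an endpoint of \<open>J\<close> inside \<open>J'\<close> would bound the arclength \<open>h\<close>,
    which takes all real values.\<close>
  have "J' = J" if J': "motion acc J' y'" "J \<subseteq> J'" "\<forall>t\<in>J. y' t = y t" for J' y'
  proof (rule ccontr)
    assume "J' \<noteq> J"
    then obtain b where b: "b \<in> J'" "b \<notin> J"
      using J'(2) by blast
    obtain w' where w': "trajectory acc J' y' w'" and J'_int: "is_interval J'"
      using J'(1) by (auto simp: motion_def)
    have J0: "0 \<in> J"
      unfolding J_def using T0 by (metis rangeI)
    \<comment> \<open>A continuation is required to agree in position only; on the open set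
      \<open>J\<close> this forces equal velocities.\<close>
    have w'_eq: "w' t = w t" if "t \<in> J" for t
    proof -
      have "(y' has_vector_derivative w' t) (at t)"
        using w' that J'(2) by (auto simp: trajectory_def)
      then have "(y has_vector_derivative w' t) (at t)"
        by (rule has_vector_derivative_transform_within_open[of _ _ _ J]) (use J that J'(3) in auto)
      then show ?thesis
        using traj that vector_derivative_unique_at unfolding trajectory_def by blast
    qed
    have seg_J': "closed_segment 0 b \<subseteq> J'"
      using J'_int J0 J'(2) b(1) by (meson closed_segment_subset is_interval_convex subsetD)
    have "compact (w' ` closed_segment 0 b)"
      using trajectory_continuous_on(2)[OF w'] seg_J'
      by (intro compact_continuous_image compact_segment) (rule continuous_on_subset)
    then obtain M where M: "M > 0" "\<forall>z\<in>w' ` closed_segment 0 b. norm z \<le> M"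
      using compact_imp_bounded bounded_pos by metis
    have h_le: "\<bar>h t\<bar> \<le> M * \<bar>b\<bar>" if t: "t \<in> J" "t \<in> closed_segment 0 b" for t
    proof -
      have seg: "closed_segment 0 t \<subseteq> J"
        using J(2) J0 t(1) by (meson closed_segment_subset is_interval_convex)
      have seg_b: "closed_segment 0 t \<subseteq> closed_segment 0 b"
        using t(2) by (simp add: subset_closed_segment)
      have "norm (h t - h 0) \<le> M * norm (t - 0)"
      proof (rule field_differentiable_bound[of "closed_segment 0 t" h "\<lambda>u. \<rho> (h u)"])
        fix u assume u: "u \<in> closed_segment 0 t"
        then show "(h has_field_derivative \<rho> (h u)) (at u within closed_segment 0 t)"
          using h' seg has_field_derivative_at_within by blast
        have "\<rho> (h u) = norm (w' u)"
          using w'_eq seg u norm_w by (metis subsetD)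
        then show "norm (\<rho> (h u)) \<le> M"
          using M(2) seg_b u by auto
      qed auto
      moreover have "h 0 = 0"
        using hT[of 0] T0 by simp
      moreover have "M * \<bar>t\<bar> \<le> M * \<bar>b\<bar>"
        using t(2) M(1) by (intro mult_left_mono) (auto simp: closed_segment_eq_real_ivl split: if_splits)
      ultimately show ?thesis
        by simp
    qed
    \<comment> \<open>An arclength on the side of \<open>b\<close> just larger than
      \<open>h_le\<close> permits. Since \<open>b\<close> lies outside the interval
      \<open>J\<close>, the point \<open>T s\<close> is between 0 and \<open>b\<close>, where
      \<open>h_le\<close> applies.\<close>
    define s where "s = sgn b * (M * \<bar>b\<bar> + 1)"
    have T_J: "T s \<in> J"
      by (simp add: J_def)
    have "T s \<in> closed_segment 0 b"
    proof (cases b "0::real" rule: linorder_cases)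
      case less
      then have "s < 0"
        using mult_nonneg_nonneg[of M "\<bar>b\<bar>"] M(1) by (simp add: s_def sgn_if)
      then have "T s < 0"
        using T_less T0 by metis
      moreover have "b \<le> T s"
        using J(2) J0 T_J b(2) less unfolding is_interval_1 by (meson linear less_imp_le)
      ultimately show ?thesis
        using less by (simp add: closed_segment_eq_real_ivl)
    next
      case equal
      then show ?thesis
        using b J0 by simp
    next
      case greater
      then have "s > 0"
        using mult_nonneg_nonneg[of M "\<bar>b\<bar>"] M(1) by (simp add: s_def sgn_if add_pos_pos)
      then have "T s > 0"
        using T_less T0 by metis
      moreover have "T s \<le> b"
        using J(2) J0 T_J b(2) greater unfolding is_interval_1 by (meson linear less_imp_le)
      ultimately show ?thesis
        using greater by (simp add: closed_segment_eq_real_ivl)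
    qed
    then have "\<bar>s\<bar> \<le> M * \<bar>b\<bar>"
      using h_le[OF T_J] hT by simp
    moreover have "b \<noteq> 0"
      using b(2) J0 by auto
    then have "\<bar>s\<bar> = M * \<bar>b\<bar> + 1"
      using M(1) by (simp add: s_def abs_mult abs_sgn_eq)
    ultimately show False
      by simp
  qed
  moreover have "motion acc J y"
    unfolding motion_def using J traj by (auto simp: J_def)
  ultimately have "maximal_motion acc J y"
    by (simp add: maximal_motion_def)
  moreover have "\<exists>s r. r > 0 \<and> y t = Y s \<and> w t = r *\<^sub>R W s" for t
    unfolding y_def w_def \<rho>_def using exp_gt_zero by blast
  ultimately show ?thesis
    using that traj by blast
qed

section \<open>From a finite endpoint to a trapped null motion\<close>

theorem trapped_null_motion:
  fixes Q :: "'a \<Rightarrow> 'a \<Rightarrow> real"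
  assumes max: "maximal_motion acc I x" and I: "bdd_above I"
    and Q_cont: "\<And>p. isCont (\<lambda>(x, v). Q x v) p"
    and Q_hom: "\<And>x c v. Q x (c *\<^sub>R v) = c\<^sup>2 * Q x v"
    and Q_const: "\<And>S x v. trajectory acc S x v \<Longrightarrow> convex S \<Longrightarrow> (\<lambda>t. Q (x t) (v t)) constant_on S"
  obtains J y w where "maximal_motion acc J y" "trajectory acc J y w" "bounded (y ` J)"
    "\<And>t. t \<in> J \<Longrightarrow> w t \<noteq> 0" "\<And>t. t \<in> J \<Longrightarrow> Q (y t) (w t) = 0"
proof -
  obtain v t0 where v: "trajectory acc I x v" and t0: "t0 \<in> I" and I': "open I" "is_interval I"
    using max unfolding maximal_motion_def motion_def by blast
  define b where "b = Sup I"
  have sub: "{t..<b} \<subseteq> I" if "t \<in> I" for t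
    using open_interval_Int_atLeast[OF I' I that] unfolding b_def by blast
  have t0b: "t0 < b"
    unfolding b_def using less_Sup_open_interval[OF I'(1) I t0] .
  have traj: "trajectory acc {t..<b} x v" if "t \<in> I" for t
    using trajectory_subset[OF v sub[OF that]] .
  have unbd: "\<not> bounded (v ` {t..<b})" if "t \<in> I" for t
    unfolding b_def using maximal_motion_unbounded_velocity[OF max v I that] .
  have blow: "1 \<le> C * (b - t) * norm (v t)" if "t \<in> {t0..<b}" for t
    using speed_blow_up[OF traj[OF t0] unbd[OF t0] that] .
  have nz: "v t \<noteq> 0" if "t \<in> {t0..<b}" for t
    using blow[OF that] by auto
  \<comment> \<open>The radius with C R^(-\<mu>) = 1/4, the threshold of
    \<open>outgoing_bounded_velocity\<close>.\<close>
  define R where "R = (4 * C) powr (1 / \<mu>)"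
  have R: "R > 0"
    using C_pos by (simp add: R_def)
  have "C * (1 + R) powr (- \<mu>) \<le> C * R powr (- \<mu>)"
    using C_pos R mu_pos by (intro mult_left_mono powr_mono2') auto
  also have "\<dots> = 1/4"
    using C_pos mu_pos by (simp add: R_def powr_powr powr_minus)
  finally have R4: "C * (1 + R) powr (- \<mu>) \<le> 1/4" .
  \<comment> \<open>An outgoing moment beyond \<open>R\<close> could serve as initial time in
    \<open>outgoing_bounded_velocity\<close>, and the velocity would be bounded up to
    \<open>b\<close>.\<close>
  have inc: "x t \<bullet> v t \<le> 0" if t: "t \<in> {t0..<b}" "norm (x t) \<ge> R" for t
  proof (rule ccontr)
    assume "\<not> x t \<bullet> v t \<le> 0"
    moreover have tI: "t \<in> I"
      using t sub[OF t0] by blast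
    ultimately have "bounded (v ` {t..<b})"
      using t R by (intro outgoing_bounded_velocity[OF traj[OF tI] nz R4]) auto
    with unbd[OF tI] show False
      by blast
  qed
  define K where "K = max R (norm (x t0))"
  have K: "norm (x t) \<le> K" if "t \<in> {t0..<b}" for t
    unfolding K_def using incoming_bounded_position[OF traj[OF t0] inc that] .
  obtain \<kappa> where \<kappa>: "\<And>t. t \<in> {t0..<b} \<Longrightarrow> Q (x t) (v t) = \<kappa>"
    using Q_const[OF traj[OF t0]] unfolding constant_on_def by auto
  obtain Y W where Y: "\<And>s. (Y has_vector_derivative W s) (at s)"
    and W: "\<And>s. (W has_vector_derivative (acc (Y s) (W s) - (W s \<bullet> acc (Y s) (W s)) *\<^sub>R W s)) (at s)"
    and YW: "\<And>s. norm (W s) = 1" "\<And>s. norm (Y s) \<le> K" "\<And>s. Q (Y s) (W s) = 0"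
    using unit_speed_limit[OF traj[OF t0] t0b blow K Q_cont Q_hom \<kappa>] by blast
  obtain J y w where J: "maximal_motion acc J y" "trajectory acc J y w"
    and yw: "\<And>t. t \<in> J \<Longrightarrow> \<exists>s r. r > 0 \<and> y t = Y s \<and> w t = r *\<^sub>R W s"
    using affine_reparametrization[OF Y W YW(1)] by blast
  show ?thesis
  proof (rule that[OF J])
    show "bounded (y ` J)"
      using yw YW(2) unfolding bounded_iff by (metis imageE)
    show "w t \<noteq> 0" "Q (y t) (w t) = 0" if t: "t \<in> J" for t
      using yw[OF t] YW(1,3) Q_hom by (auto simp: norm_eq_zero) (metis norm_zero zero_neq_one)
  qed
qed

end

section \<open>Time reversal\<close>

lemma trajectory_reverse:
  fixes acc :: "'a::real_normed_vector \<Rightarrow> 'a \<Rightarrow> 'a"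
  assumes "trajectory acc I x v" and even: "\<And>x v. acc x (- v) = acc x v"
  shows "trajectory acc (uminus ` I) (\<lambda>t. x (- t)) (\<lambda>t. - v (- t))"
  unfolding trajectory_def
proof (intro ballI conjI)
  fix t assume "t \<in> uminus ` I"
  then have "- t \<in> I"
    by auto
  then have x: "(x has_vector_derivative v (- t)) (at (- t))"
    and v: "(v has_vector_derivative acc (x (- t)) (v (- t))) (at (- t))"
    using assms(1) by (auto simp: trajectory_def)
  have m: "(uminus has_vector_derivative -1) (at t)"
    by (auto intro!: derivative_eq_intros)
  show "((\<lambda>t. x (- t)) has_vector_derivative - v (- t)) (at t)"
    using vector_diff_chain_at[OF m x] by (simp add: o_def)
  have "((\<lambda>t. v (- t)) has_vector_derivative - acc (x (- t)) (v (- t))) (at t)"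
    using vector_diff_chain_at[OF m v] by (simp add: o_def)
  then show "((\<lambda>t. - v (- t)) has_vector_derivative acc (x (- t)) (- v (- t))) (at t)"
    unfolding even using has_vector_derivative_minus by fastforce
qed

lemma motion_reverse:
  fixes acc :: "'a::real_normed_vector \<Rightarrow> 'a \<Rightarrow> 'a"
  assumes "motion acc I x" and even: "\<And>x v. acc x (- v) = acc x v"
  shows "motion acc (uminus ` I) (\<lambda>t. x (- t))"
proof -
  obtain v where I: "open I" "is_interval I" "I \<noteq> {}" and v: "trajectory acc I x v"
    using assms(1) unfolding motion_def by blast
  have "is_interval (uminus ` I)"
    using I(2) by (simp add: is_interval_connected_1 connected_continuous_image continuous_on_minus)
  moreover have "open (uminus ` I)"
    using I(1) by (rule open_negations)
  ultimately show ?thesis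
    using I(3) trajectory_reverse[of acc I x v] v even unfolding motion_def by blast
qed

lemma maximal_motion_reverse:
  fixes acc :: "'a::real_normed_vector \<Rightarrow> 'a \<Rightarrow> 'a"
  assumes max: "maximal_motion acc I x" and even: "\<And>x v. acc x (- v) = acc x v"
  shows "maximal_motion acc (uminus ` I) (\<lambda>t. x (- t))"
  unfolding maximal_motion_def
proof (intro conjI allI impI)
  show "motion acc (uminus ` I) (\<lambda>t. x (- t))"
    using max motion_reverse[of acc I x] even unfolding maximal_motion_def by blast
  fix J y assume J: "motion acc J y" "uminus ` I \<subseteq> J" "\<forall>t\<in>uminus ` I. y t = x (- t)"
  have "motion acc (uminus ` J) (\<lambda>t. y (- t))"
    using motion_reverse[of acc J y] J(1) even by blast
  moreover have "I \<subseteq> uminus ` J"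
  proof
    fix t assume "t \<in> I"
    then have "- t \<in> J"
      using J(2) by blast
    then show "t \<in> uminus ` J"
      by (metis image_eqI minus_minus)
  qed
  moreover have "\<forall>t\<in>I. y (- t) = x t"
    using J(3) by simp
  ultimately have "uminus ` J = I"
    using max unfolding maximal_motion_def by blast
  then have "uminus ` uminus ` J = uminus ` I"
    by simp
  then show "J = uminus ` I"
    by (simp add: image_image)
qed

section \<open>The geodesic spray of an asymptotically Minkowski metric\<close>

lemma smooth_differentiable:
  fixes f :: "real ^ 'm \<Rightarrow> real"
  assumes "smooth f"
  shows "f differentiable (at x)"
proof -
  have "partials [] f differentiable_on UNIV"
    using assms unfolding smooth_def ..
  then show ?thesis
    by (simp add: partials_def differentiable_on_def)
qed

lemma smooth_partial: "smooth f \<Longrightarrow> smooth (partial i f)"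
  unfolding smooth_def
proof
  fix js assume "\<forall>is. partials is f differentiable_on UNIV"
  \<comment> \<open>The index is appended at the end because \<open>foldr\<close> applies the last
    entry of the list first.\<close>
  then have "partials (js @ [i]) f differentiable_on UNIV"
    by blast
  then show "partials js (partial i f) differentiable_on UNIV"
    by (simp add: partials_def)
qed

lemma frechet_derivative_partials:
  fixes f :: "real ^ 'm \<Rightarrow> real"
  assumes "f differentiable (at x)"
  shows "frechet_derivative f (at x) h = (\<Sum>i\<in>UNIV. h $ i * partial i f x)"
proof -
  have lin: "linear (frechet_derivative f (at x))"
    using assms frechet_derivative_works has_derivative_linear by blast
  have "frechet_derivative f (at x) (\<Sum>i\<in>UNIV. h $ i *\<^sub>R axis i 1)
      = (\<Sum>i\<in>UNIV. h $ i *\<^sub>R partial i f x)"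
    by (simp add: linear_sum[OF lin] linear_cmul[OF lin] partial_def)
  then show ?thesis
    using basis_expansion[of h] by (simp add: scalar_mult_eq_scaleR)
qed

lemma smooth_lipschitz_on_balls:
  fixes f :: "real ^ 'm \<Rightarrow> real"
  assumes f: "smooth f"
  shows "lipschitz_on_balls f"
  unfolding lipschitz_on_balls_def
proof
  fix R :: real
  have "\<exists>B. \<forall>x\<in>cball 0 R. \<bar>partial i f x\<bar> \<le> B" for i
  proof -
    have "continuous_on (cball 0 R) (partial i f)"
      using smooth_differentiable[OF smooth_partial[OF f]]
      by (meson continuous_at_imp_continuous_on differentiable_imp_continuous_within)
    then have "bounded (partial i f ` cball 0 R)"
      by (intro compact_imp_bounded compact_continuous_image compact_cball)
    then show ?thesis
      by (auto simp: bounded_iff)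
  qed
  then obtain B where B: "\<And>i x. x \<in> cball 0 R \<Longrightarrow> \<bar>partial i f x\<bar> \<le> B i"
    by metis
  have "(\<Sum>i\<in>UNIV. \<bar>B i\<bar>)-lipschitz_on (cball 0 R) f"
  proof (rule bounded_derivative_imp_lipschitz)
    fix x :: "real ^ 'm" assume x: "x \<in> cball 0 R"
    have d: "f differentiable (at x)"
      using f by (rule smooth_differentiable)
    then show "(f has_derivative frechet_derivative f (at x)) (at x within cball 0 R)"
      using frechet_derivative_works has_derivative_at_withinI by blast
    show "onorm (frechet_derivative f (at x)) \<le> (\<Sum>i\<in>UNIV. \<bar>B i\<bar>)"
    proof (rule onorm_le)
      fix h :: "real ^ 'm"
      have "norm (frechet_derivative f (at x) h) \<le> (\<Sum>i\<in>UNIV. norm (h $ i * partial i f x))"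
        unfolding frechet_derivative_partials[OF d] by (rule norm_sum)
      also have "\<dots> \<le> (\<Sum>i\<in>UNIV. norm h * \<bar>B i\<bar>)"
        using order_trans[OF B[OF x] abs_ge_self]
        by (intro sum_mono) (auto simp: abs_mult intro!: mult_mono component_le_norm_cart)
      finally show "norm (frechet_derivative f (at x) h) \<le> (\<Sum>i\<in>UNIV. \<bar>B i\<bar>) * norm h"
        by (simp add: sum_distrib_left mult.commute)
    qed
  qed (auto intro: sum_nonneg)
  then show "\<exists>L. L-lipschitz_on (cball 0 R) f"
    by blast
qed

lemma minkowski_involution: "minkowski i ** minkowski i = mat 1"
proof -
  have "(\<Sum>k\<in>UNIV. minkowski i $ j $ k * minkowski i $ k $ l)
      = (\<Sum>k\<in>UNIV. if j = k then minkowski i $ j $ j * minkowski i $ j $ l else 0)" for j l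
    by (intro sum.cong) (auto simp: minkowski_def)
  then show ?thesis
    by (simp add: vec_eq_iff matrix_matrix_mult_def mat_def) (simp add: minkowski_def)
qed

lemma matrix_inv_mult:
  fixes A :: "real ^ 'n ^ 'n"
  assumes "invertible A"
  shows "A ** matrix_inv A = mat 1" "matrix_inv A ** A = mat 1"
  using someI_ex[OF assms[unfolded invertible_def]] by (simp_all add: matrix_inv_def)

text \<open>The Minkowski matrix is its own inverse, so its determinant is nonzero, and then no
  factor of the determinant of the congruence can vanish.\<close>

lemma lorentzian_metric_invertible:
  fixes g :: "real ^ 'm \<Rightarrow> real ^ 'm ^ 'm"
  assumes "lorentzian_metric g"
  shows "invertible (g x)"
proof -
  obtain P :: "real ^ 'm ^ 'm" and i where "transpose P ** g x ** P = minkowski i"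
    using assms unfolding lorentzian_metric_def by blast
  then have "det (transpose P) * det (g x) * det P = det (minkowski i)"
    by (metis det_mul)
  moreover have "det (minkowski i) * det (minkowski i) = 1"
    by (metis det_I det_mul minkowski_involution)
  ultimately show ?thesis
    by (auto simp: invertible_det_nz)
qed

lemma japanese_bracket_ge: "japanese_bracket x \<ge> 1" "japanese_bracket x \<ge> norm x"
  "2 * japanese_bracket x \<ge> 1 + norm x"
proof -
  show 1: "japanese_bracket x \<ge> 1" and 2: "japanese_bracket x \<ge> norm x"
    unfolding japanese_bracket_def by (auto intro: real_le_rsqrt)
  show "2 * japanese_bracket x \<ge> 1 + norm x"
    using 1 2 by linarith
qed

section \<open>Geodesics as motions and conservation of energy\<close>

definition geodesic_acceleration :: "(real ^ 'm \<Rightarrow> real ^ 'm ^ 'm) \<Rightarrow> real ^ 'm \<Rightarrow> real ^ 'm \<Rightarrow> real ^ 'm"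
  where "geodesic_acceleration g x v =
    (\<chi> i. - (\<Sum>j\<in>UNIV. \<Sum>k\<in>UNIV. christoffel g i j k x * v $ j * v $ k))"

lemma geodesic_on_iff_motion: "geodesic_on g I \<gamma> \<longleftrightarrow> motion (geodesic_acceleration g) I \<gamma>"
  by (simp add: geodesic_on_def motion_def trajectory_def geodesic_acceleration_def)

lemma maximal_geodesic_iff_maximal_motion:
  "maximal_geodesic g I \<gamma> \<longleftrightarrow> maximal_motion (geodesic_acceleration g) I \<gamma>"
  by (simp add: maximal_geodesic_def maximal_motion_def geodesic_on_iff_motion)

lemma geodesic_acceleration_scaleR:
  "geodesic_acceleration g x (c *\<^sub>R v) = c\<^sup>2 *\<^sub>R geodesic_acceleration g x v"
  by (simp add: geodesic_acceleration_def vec_eq_iff sum_distrib_left power2_eq_square mult_ac)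

definition energy :: "(real ^ 'm \<Rightarrow> real ^ 'm ^ 'm) \<Rightarrow> real ^ 'm \<Rightarrow> real ^ 'm \<Rightarrow> real"
  where "energy g x v = v \<bullet> (g x *v v)"

lemma energy_scaleR: "energy g x (c *\<^sub>R v) = c\<^sup>2 * energy g x v"
  by (simp add: energy_def matrix_vector_mult_scaleR power2_eq_square)

lemma energy_sum: "energy g x v = (\<Sum>a\<in>UNIV. \<Sum>b\<in>UNIV. v $ a * (g x $ a $ b * v $ b))"
  by (simp add: energy_def inner_vec_def matrix_vector_mult_def sum_distrib_left)

lemma has_real_derivative_vec_nth:
  fixes f :: "real \<Rightarrow> real ^ 'm"
  assumes "(f has_vector_derivative f') (at t)"
  shows "((\<lambda>t. f t $ i) has_real_derivative f' $ i) (at t)"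
  using bounded_linear.has_vector_derivative[OF bounded_linear_vec_nth assms]
  by (simp add: has_real_derivative_iff_has_vector_derivative)

lemma has_real_derivative_along_curve:
  fixes f :: "real ^ 'm \<Rightarrow> real"
  assumes "f differentiable (at (x t))" and "(x has_vector_derivative v) (at t)"
  shows "((\<lambda>t. f (x t)) has_real_derivative (\<Sum>i\<in>UNIV. v $ i * partial i f (x t))) (at t)"
proof -
  have "((f \<circ> x) has_derivative (frechet_derivative f (at (x t)) \<circ> (\<lambda>h. h *\<^sub>R v))) (at t)"
    using assms by (intro diff_chain_at) (auto simp: has_vector_derivative_def frechet_derivative_works)
  moreover have "frechet_derivative f (at (x t)) \<circ> (\<lambda>h. h *\<^sub>R v) = (*) (\<Sum>i\<in>UNIV. v $ i * partial i f (x t))"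
    by (simp add: fun_eq_iff frechet_derivative_partials[OF assms(1)] sum_distrib_left sum_distrib_right mult_ac)
  ultimately show ?thesis
    by (simp add: has_field_derivative_def o_def)
qed

locale lorentzian =
  fixes g :: "real ^ 'm::finite \<Rightarrow> real ^ 'm ^ 'm"
  assumes metric: "lorentzian_metric g"
begin

lemma smooth_metric: "smooth (\<lambda>x. g x $ a $ b)"
  and metric_sym: "g x $ a $ b = g x $ b $ a"
proof -
  show "smooth (\<lambda>x. g x $ a $ b)"
    using metric by (simp add: lorentzian_metric_def)
  have "transpose (g x) = g x"
    using metric by (simp add: lorentzian_metric_def)
  then have "transpose (g x) $ b $ a = g x $ b $ a"
    by simp
  then show "g x $ a $ b = g x $ b $ a"
    by (simp add: transpose_def)
qed

lemma metric_inverse: "g x ** inverse_metric g x = mat 1" "inverse_metric g x ** g x = mat 1"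
  unfolding inverse_metric_def using matrix_inv_mult lorentzian_metric_invertible[OF metric] by blast+

text \<open>Lowering the index cancels the inverse metric inside the Christoffel symbols and leaves
  those of the first kind, which are linear in the derivatives of \<open>g\<close>.\<close>

lemma lower_geodesic_acceleration:
  "(\<Sum>i\<in>UNIV. g x $ a $ i * geodesic_acceleration g x v $ i) =
    - (\<Sum>j\<in>UNIV. \<Sum>k\<in>UNIV. (1/2) * (partial j (\<lambda>y. g y $ k $ a) x + partial k (\<lambda>y. g y $ j $ a) x
        - partial a (\<lambda>y. g y $ j $ k) x) * v $ j * v $ k)"
proof -
  define D where "D j k l = (1/2) * (partial j (\<lambda>y. g y $ k $ l) x + partial k (\<lambda>y. g y $ j $ l) x
        - partial l (\<lambda>y. g y $ j $ k) x)" for j k l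
  have chr: "christoffel g i j k x = (\<Sum>l\<in>UNIV. inverse_metric g x $ i $ l * D j k l)" for i j k
    by (simp add: christoffel_def D_def sum_distrib_left mult_ac)
  have "(\<Sum>i\<in>UNIV. g x $ a $ i * inverse_metric g x $ i $ l) = (if a = l then 1 else 0)" for l
    using metric_inverse(1)[of x] by (simp add: vec_eq_iff matrix_matrix_mult_def mat_def)
  then have low: "(\<Sum>i\<in>UNIV. g x $ a $ i * christoffel g i j k x) = D j k a" for j k
    unfolding chr sum_distrib_left
    by (subst sum.swap)
      (simp add: mult.assoc[symmetric] if_distrib[where f = "\<lambda>z. z * _"] cong: if_cong flip: sum_distrib_right)
  have "(\<Sum>i\<in>UNIV. g x $ a $ i * geodesic_acceleration g x v $ i)
      = - (\<Sum>i\<in>UNIV. \<Sum>j\<in>UNIV. \<Sum>k\<in>UNIV. g x $ a $ i * christoffel g i j k x * v $ j * v $ k)"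
    by (simp add: geodesic_acceleration_def sum_distrib_left sum_negf mult_ac)
  also have "(\<Sum>i\<in>UNIV. \<Sum>j\<in>UNIV. \<Sum>k\<in>UNIV. g x $ a $ i * christoffel g i j k x * v $ j * v $ k)
      = (\<Sum>j\<in>UNIV. \<Sum>k\<in>UNIV. \<Sum>i\<in>UNIV. g x $ a $ i * christoffel g i j k x * v $ j * v $ k)"
    by (subst sum.swap) (intro sum.cong refl sum.swap)
  also have "\<dots> = (\<Sum>j\<in>UNIV. \<Sum>k\<in>UNIV. D j k a * v $ j * v $ k)"
    by (simp add: low flip: sum_distrib_right)
  finally show ?thesis
    unfolding D_def .
qed

text \<open>With S3 the full contraction of the derivatives of \<open>g\<close> with three copies of
  the velocity, differentiating \<open>g\<close> contributes S3. Each of the two velocity factors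
  contributes g(A, w) = -S3/2: the three first-kind terms, of signs +, +, -, all contract to S3
  after renaming indices.\<close>

lemma energy_conserved:
  assumes traj: "trajectory (geodesic_acceleration g) S x v" and S: "convex S"
  shows "(\<lambda>t. energy g (x t) (v t)) constant_on S"
proof -
  have "((\<lambda>t. energy g (x t) (v t)) has_real_derivative 0) (at t)" if t: "t \<in> S" for t
  proof -
    define A where "A = geodesic_acceleration g (x t) (v t)"
    define T where "T c a b = partial c (\<lambda>y. g y $ a $ b) (x t)" for a b c
    define w where "w = v t"
    define G where "G = g (x t)"
    have x': "(x has_vector_derivative w) (at t)" and v': "(v has_vector_derivative A) (at t)"
      using traj t by (auto simp: trajectory_def A_def w_def)
    have g': "((\<lambda>t. g (x t) $ a $ b) has_real_derivative (\<Sum>c\<in>UNIV. w $ c * T c a b)) (at t)" for a b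
      unfolding T_def using has_real_derivative_along_curve[OF smooth_differentiable[OF smooth_metric] x'] .
    define S3 where "S3 = (\<Sum>a\<in>UNIV. \<Sum>b\<in>UNIV. \<Sum>c\<in>UNIV. w $ a * w $ b * w $ c * T c a b)"
    have d: "((\<lambda>t. energy g (x t) (v t)) has_real_derivative
        (\<Sum>a\<in>UNIV. \<Sum>b\<in>UNIV. A $ a * (G $ a $ b * w $ b) +
          ((\<Sum>c\<in>UNIV. w $ c * T c a b) * w $ b + A $ b * G $ a $ b) * w $ a)) (at t)"
      unfolding energy_sum w_def G_def
      by (intro DERIV_sum DERIV_mult has_real_derivative_vec_nth v' g'[unfolded w_def])
    have "(\<Sum>a\<in>UNIV. \<Sum>b\<in>UNIV. A $ a * (G $ a $ b * w $ b)) = (\<Sum>b\<in>UNIV. \<Sum>a\<in>UNIV. A $ a * (G $ a $ b * w $ b))"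
      by (rule sum.swap)
    also have "\<dots> = (\<Sum>a\<in>UNIV. w $ a * (\<Sum>b\<in>UNIV. G $ a $ b * A $ b))"
      using metric_sym by (auto simp: sum_distrib_left mult_ac G_def intro!: sum.cong)
    finally have 1: "(\<Sum>a\<in>UNIV. \<Sum>b\<in>UNIV. A $ a * (G $ a $ b * w $ b))
        = (\<Sum>a\<in>UNIV. w $ a * (\<Sum>b\<in>UNIV. G $ a $ b * A $ b))" .
    have 2: "(\<Sum>a\<in>UNIV. \<Sum>b\<in>UNIV. A $ b * G $ a $ b * w $ a) = (\<Sum>a\<in>UNIV. w $ a * (\<Sum>b\<in>UNIV. G $ a $ b * A $ b))"
      by (simp add: sum_distrib_left mult_ac)
    have 3: "(\<Sum>a\<in>UNIV. \<Sum>b\<in>UNIV. (\<Sum>c\<in>UNIV. w $ c * T c a b) * w $ b * w $ a) = S3"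
      by (simp add: S3_def sum_distrib_left sum_distrib_right mult_ac)
    have p1: "(\<Sum>a\<in>UNIV. \<Sum>j\<in>UNIV. \<Sum>k\<in>UNIV. w $ a * w $ j * w $ k * T j k a) = S3"
    proof -
      have "(\<Sum>a\<in>UNIV. \<Sum>j\<in>UNIV. \<Sum>k\<in>UNIV. w $ a * w $ j * w $ k * T j k a)
          = (\<Sum>a\<in>UNIV. \<Sum>k\<in>UNIV. \<Sum>j\<in>UNIV. w $ a * w $ j * w $ k * T j k a)"
        by (intro sum.cong refl sum.swap)
      also have "\<dots> = (\<Sum>k\<in>UNIV. \<Sum>a\<in>UNIV. \<Sum>j\<in>UNIV. w $ a * w $ j * w $ k * T j k a)"
        by (rule sum.swap)
      finally show ?thesis
        by (simp add: S3_def mult_ac)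
    qed
    have p2: "(\<Sum>a\<in>UNIV. \<Sum>j\<in>UNIV. \<Sum>k\<in>UNIV. w $ a * w $ j * w $ k * T k j a) = S3"
    proof -
      have "(\<Sum>a\<in>UNIV. \<Sum>j\<in>UNIV. \<Sum>k\<in>UNIV. w $ a * w $ j * w $ k * T k j a)
          = (\<Sum>j\<in>UNIV. \<Sum>a\<in>UNIV. \<Sum>k\<in>UNIV. w $ a * w $ j * w $ k * T k j a)"
        by (rule sum.swap)
      then show ?thesis
        by (simp add: S3_def mult_ac)
    qed
    have p3: "(\<Sum>a\<in>UNIV. \<Sum>j\<in>UNIV. \<Sum>k\<in>UNIV. w $ a * w $ j * w $ k * T a j k) = S3"
    proof -
      have "(\<Sum>a\<in>UNIV. \<Sum>j\<in>UNIV. \<Sum>k\<in>UNIV. w $ a * w $ j * w $ k * T a j k)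
          = (\<Sum>j\<in>UNIV. \<Sum>a\<in>UNIV. \<Sum>k\<in>UNIV. w $ a * w $ j * w $ k * T a j k)"
        by (rule sum.swap)
      also have "\<dots> = (\<Sum>j\<in>UNIV. \<Sum>k\<in>UNIV. \<Sum>a\<in>UNIV. w $ a * w $ j * w $ k * T a j k)"
        by (intro sum.cong refl sum.swap)
      finally show ?thesis
        by (simp add: S3_def mult_ac)
    qed
    have low: "(\<Sum>b\<in>UNIV. G $ a $ b * A $ b) =
        - (\<Sum>j\<in>UNIV. \<Sum>k\<in>UNIV. (1/2) * (T j k a + T k j a - T a j k) * w $ j * w $ k)" for a
      unfolding G_def A_def T_def w_def by (rule lower_geodesic_acceleration)
    have "(\<Sum>a\<in>UNIV. w $ a * (\<Sum>b\<in>UNIV. G $ a $ b * A $ b)) =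
        - (1/2) * ((\<Sum>a\<in>UNIV. \<Sum>j\<in>UNIV. \<Sum>k\<in>UNIV. w $ a * w $ j * w $ k * T j k a)
          + (\<Sum>a\<in>UNIV. \<Sum>j\<in>UNIV. \<Sum>k\<in>UNIV. w $ a * w $ j * w $ k * T k j a)
          - (\<Sum>a\<in>UNIV. \<Sum>j\<in>UNIV. \<Sum>k\<in>UNIV. w $ a * w $ j * w $ k * T a j k))"
      unfolding low sum_distrib_left sum.distrib[symmetric] sum_subtractf[symmetric] sum_negf[symmetric]
      by (intro sum.cong refl) (simp add: algebra_simps)
    then have 4: "(\<Sum>a\<in>UNIV. w $ a * (\<Sum>b\<in>UNIV. G $ a $ b * A $ b)) = - S3 / 2"
      unfolding p1 p2 p3 by simp
    have "(\<Sum>a\<in>UNIV. \<Sum>b\<in>UNIV. A $ a * (G $ a $ b * w $ b) +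
          ((\<Sum>c\<in>UNIV. w $ c * T c a b) * w $ b + A $ b * G $ a $ b) * w $ a) = 0"
      using 1 2 3 4 by (simp add: sum.distrib distrib_right)
    with d show ?thesis
      by simp
  qed
  then have "\<exists>c. \<forall>t\<in>S. energy g (x t) (v t) = c"
    using S by (intro has_field_derivative_zero_constant) (auto intro: has_field_derivative_at_within)
  then show ?thesis
    by (simp add: constant_on_def)
qed

lemma lipschitz_on_balls_geodesic_acceleration:
  assumes H: "\<And>j k. lipschitz_on_balls (\<lambda>x. inverse_metric g x $ j $ k)"
  shows "lipschitz_on_balls (\<lambda>(x, v). geodesic_acceleration g x v)"
proof -
  have fst: "lipschitz_on_balls (fst :: (real ^ 'm) \<times> (real ^ 'm) \<Rightarrow> _)"
    and snd_i: "lipschitz_on_balls (\<lambda>p :: (real ^ 'm) \<times> (real ^ 'm). snd p $ i)" for i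
    by (auto intro: bounded_linear_lipschitz_on_balls bounded_linear_fst
        bounded_linear_compose[OF bounded_linear_vec_nth bounded_linear_snd])
  have "lipschitz_on_balls (christoffel g i j k)" for i j k
    unfolding christoffel_def[abs_def]
    by (intro lipschitz_on_balls_mult lipschitz_on_balls_sum lipschitz_on_balls_diff
        lipschitz_on_balls_add lipschitz_on_balls_const H
        smooth_lipschitz_on_balls smooth_partial smooth_metric)
  then show ?thesis
    unfolding geodesic_acceleration_def case_prod_beta'
    by (intro lipschitz_on_balls_vec_lambda lipschitz_on_balls_minus lipschitz_on_balls_sum
        lipschitz_on_balls_mult snd_i lipschitz_on_balls_compose[OF fst])
qed

lemma isCont_energy: "isCont (\<lambda>(x, v). energy g x v) p"
proof -
  have fst: "lipschitz_on_balls (fst :: (real ^ 'm) \<times> (real ^ 'm) \<Rightarrow> _)"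
    and snd_i: "lipschitz_on_balls (\<lambda>p :: (real ^ 'm) \<times> (real ^ 'm). snd p $ i)" for i
    by (auto intro: bounded_linear_lipschitz_on_balls bounded_linear_fst
        bounded_linear_compose[OF bounded_linear_vec_nth bounded_linear_snd])
  have "lipschitz_on_balls (\<lambda>(x, v). energy g x v)"
    unfolding energy_sum case_prod_beta'
    by (intro lipschitz_on_balls_sum lipschitz_on_balls_mult snd_i
        lipschitz_on_balls_compose[OF fst] smooth_lipschitz_on_balls smooth_metric)
  then show ?thesis
    by (rule lipschitz_on_balls_isCont)
qed

section \<open>Decay of the geodesic acceleration\<close>

text \<open>Differentiating g g^(-1) = 1 gives dg = - g d(g^(-1)) g. This transfers the symbol
  estimates, which concern the inverse metric, to the derivatives of \<open>g\<close> in the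
  Christoffel symbols.\<close>

lemma partial_metric:
  assumes D: "\<And>j k. (\<lambda>x. inverse_metric g x $ j $ k) differentiable (at x)"
  shows "partial l (\<lambda>y. g y $ a $ d) x = - (\<Sum>c\<in>UNIV. (\<Sum>b\<in>UNIV. g x $ a $ b *
    partial l (\<lambda>y. inverse_metric g y $ b $ c) x) * g x $ c $ d)"
proof -
  define g' :: "real ^ 'm ^ 'm" where "g' = (\<chi> a b. partial l (\<lambda>y. g y $ a $ b) x)"
  define h' :: "real ^ 'm ^ 'm" where "h' = (\<chi> b c. partial l (\<lambda>y. inverse_metric g y $ b $ c) x)"
  have "(g' ** inverse_metric g x + g x ** h') $ a $ c = 0" for a c
  proof -
    have gd: "((\<lambda>y. g y $ a $ b) has_derivative frechet_derivative (\<lambda>y. g y $ a $ b) (at x)) (at x)" for b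
      using smooth_differentiable[OF smooth_metric] frechet_derivative_works by blast
    have hd: "((\<lambda>y. inverse_metric g y $ b $ c) has_derivative
        frechet_derivative (\<lambda>y. inverse_metric g y $ b $ c) (at x)) (at x)" for b
      using D frechet_derivative_works by blast
    have d: "((\<lambda>y. \<Sum>b\<in>UNIV. g y $ a $ b * inverse_metric g y $ b $ c) has_derivative
        (\<lambda>h. \<Sum>b\<in>UNIV. g x $ a $ b * frechet_derivative (\<lambda>y. inverse_metric g y $ b $ c) (at x) h
          + frechet_derivative (\<lambda>y. g y $ a $ b) (at x) h * inverse_metric g x $ b $ c)) (at x)"
      by (intro has_derivative_sum has_derivative_mult gd hd)
    have const: "(\<lambda>y. \<Sum>b\<in>UNIV. g y $ a $ b * inverse_metric g y $ b $ c) = (\<lambda>y. mat 1 $ a $ c)"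
    proof
      fix y
      show "(\<Sum>b\<in>UNIV. g y $ a $ b * inverse_metric g y $ b $ c) = mat 1 $ a $ c"
        using arg_cong[OF metric_inverse(1)[of y], of "\<lambda>M. M $ a $ c"] by (simp add: matrix_matrix_mult_def)
    qed
    have "(\<lambda>h. \<Sum>b\<in>UNIV. g x $ a $ b * frechet_derivative (\<lambda>y. inverse_metric g y $ b $ c) (at x) h
          + frechet_derivative (\<lambda>y. g y $ a $ b) (at x) h * inverse_metric g x $ b $ c) = (\<lambda>h. 0)"
      by (rule has_derivative_unique[OF d[unfolded const] has_derivative_const])
    then have "(\<Sum>b\<in>UNIV. g x $ a $ b * partial l (\<lambda>y. inverse_metric g y $ b $ c) x
          + partial l (\<lambda>y. g y $ a $ b) x * inverse_metric g x $ b $ c) = 0"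
      unfolding partial_def by (rule fun_cong)
    then show ?thesis
      by (simp add: matrix_matrix_mult_def g'_def h'_def sum.distrib add.commute)
  qed
  then have "g' ** inverse_metric g x = - (g x ** h')"
    by (simp add: vec_eq_iff eq_neg_iff_add_eq_0)
  then have "g' ** (inverse_metric g x ** g x) = (- (g x ** h')) ** g x"
    by (simp add: matrix_mul_assoc)
  then have "g' $ a $ d = ((- (g x ** h')) ** g x) $ a $ d"
    by (simp add: metric_inverse)
  then show ?thesis
    by (simp add: g'_def h'_def matrix_matrix_mult_def sum_negf)
qed

text \<open>The chain of estimates: the inverse metric is bounded, hence \<open>g\<close> is
  bounded; by \<open>partial_metric\<close> its derivatives then decay like those of the inverse,
  and so do the Christoffel symbols.\<close>

lemma spray_geodesic_acceleration:
  assumes mu: "\<mu> > 0"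
    and symbol: "\<And>j k. (\<lambda>x. inverse_metric g x $ j $ k - minkowski i $ j $ k) \<in> symbol_class (- \<mu>)"
  obtains C where "spray (geodesic_acceleration g) C \<mu>"
proof -
  let ?jb = "japanese_bracket :: real ^ 'm \<Rightarrow> real"
  define N where "N = real CARD('m)"
  have N: "N \<ge> 1"
    by (simp add: N_def Suc_leI)
  define D where "D j k x = inverse_metric g x $ j $ k - minkowski i $ j $ k" for j k x
  have D_smooth: "smooth (D j k)" for j k
    using symbol unfolding symbol_class_def D_def by blast
  have H_eq: "(\<lambda>x. inverse_metric g x $ j $ k) = (\<lambda>x. D j k x + minkowski i $ j $ k)" for j k
    by (simp add: D_def)
  have jb_pos: "?jb x > 0" for x
    using japanese_bracket_ge(1)[of x] by linarith
  have H_lip: "lipschitz_on_balls (\<lambda>x. inverse_metric g x $ j $ k)" for j k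
    unfolding H_eq by (intro lipschitz_on_balls_add lipschitz_on_balls_const smooth_lipschitz_on_balls D_smooth)
  have H_deriv: "((\<lambda>x. inverse_metric g x $ j $ k) has_derivative frechet_derivative (D j k) (at x)) (at x)" for j k x
    unfolding H_eq using iffD1[OF frechet_derivative_works smooth_differentiable[OF D_smooth]]
    by (auto intro!: derivative_eq_intros)
  have H_partial: "partial l (\<lambda>x. inverse_metric g x $ j $ k) x = partial l (D j k) x" for l j k x
    unfolding partial_def using frechet_derivative_at[OF H_deriv] by metis
  have "\<exists>c. \<forall>x. \<bar>partials js (D j k) x\<bar> \<le> c * ?jb x powr (- \<mu> - real (length js))" for j k js
    using symbol unfolding symbol_class_def D_def by blast
  then have "\<exists>C. \<forall>js x. \<bar>partials js (D j k) x\<bar> \<le> C js * ?jb x powr (- \<mu> - real (length js))" for j k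
    by (intro choice allI)
  then obtain C where C: "\<And>j k js x. \<bar>partials js (D j k) x\<bar> \<le> C j k js * ?jb x powr (- \<mu> - real (length js))"
    by metis
  define C0 where "C0 = (\<Sum>j\<in>UNIV. \<Sum>k\<in>UNIV. \<bar>C j k []\<bar>)"
  define C1 where "C1 = (\<Sum>l\<in>UNIV. \<Sum>j\<in>UNIV. \<Sum>k\<in>UNIV. \<bar>C j k [l]\<bar>)"
  have C01: "C0 \<ge> 0" "C1 \<ge> 0"
    by (auto simp: C0_def C1_def intro!: sum_nonneg)
  have "\<bar>C j k []\<bar> \<le> C0" for j k
    unfolding C0_def
    by (rule order_trans[OF member_le_sum[of k UNIV "\<lambda>k. \<bar>C j k []\<bar>"]
          member_le_sum[of j UNIV "\<lambda>j. \<Sum>k\<in>UNIV. \<bar>C j k []\<bar>"]]) (auto intro: sum_nonneg)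
  then have D_le: "\<bar>D j k x\<bar> \<le> C0 * ?jb x powr (- \<mu>)" for j k x
    using C[of "[]" j k x] mult_right_mono[of "C j k []" C0 "?jb x powr (- \<mu>)"]
    by (simp add: partials_def) (meson abs_ge_self order_trans)
  have "\<bar>C j k [l]\<bar> \<le> C1" for j k l
    unfolding C1_def
    by (rule order_trans[OF order_trans[OF member_le_sum[of k UNIV "\<lambda>k. \<bar>C j k [l]\<bar>"]
          member_le_sum[of j UNIV "\<lambda>j. \<Sum>k\<in>UNIV. \<bar>C j k [l]\<bar>"]]
          member_le_sum[of l UNIV "\<lambda>l. \<Sum>j\<in>UNIV. \<Sum>k\<in>UNIV. \<bar>C j k [l]\<bar>"]]) (auto intro!: sum_nonneg)
  then have D'_le: "\<bar>partial l (D j k) x\<bar> \<le> C1 * ?jb x powr (- \<mu> - 1)" for l j k x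
    using C[of "[l]" j k x] mult_right_mono[of "C j k [l]" C1 "?jb x powr (- \<mu> - 1)"]
    by (simp add: partials_def) (meson abs_ge_self order_trans)
  have jb_powr_le: "?jb x powr (- \<mu>) \<le> 1" for x
    using powr_mono[of "- \<mu>" 0 "?jb x"] japanese_bracket_ge(1)[of x] mu by simp
  have H_le: "\<bar>inverse_metric g x $ j $ k\<bar> \<le> C0 + 1" for x j k
  proof -
    have "\<bar>D j k x\<bar> \<le> C0 * 1"
      using D_le[of j k x] mult_left_mono[OF jb_powr_le C01(1)] order_trans by blast
    moreover have "\<bar>minkowski i $ j $ k\<bar> \<le> 1"
      by (simp add: minkowski_def)
    ultimately show ?thesis
      by (simp add: D_def)
  qed
  have "\<exists>B. \<forall>x a b. \<bar>g x $ a $ b\<bar> \<le> B"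
  proof -
    \<comment> \<open>By \<open>g g\<^sup>-\<^sup>1 = 1\<close> the size \<open>m\<close> of \<open>g\<close> satisfies \<open>m \<le> N\<^sup>2 (1 + m e)\<close> with \<open>e\<close> small far out.\<close>
    define m where "m x = (\<Sum>a\<in>UNIV. \<Sum>b\<in>UNIV. \<bar>g x $ a $ b\<bar>)" for x
    have g_le_m: "\<bar>g x $ a $ b\<bar> \<le> m x" for x a b
      unfolding m_def
      by (rule order_trans[OF member_le_sum[of b UNIV "\<lambda>b. \<bar>g x $ a $ b\<bar>"]
            member_le_sum[of a UNIV "\<lambda>a. \<Sum>b\<in>UNIV. \<bar>g x $ a $ b\<bar>"]]) (auto intro: sum_nonneg)
    define e where "e x = C0 * ?jb x powr (- \<mu>)" for x
    have e: "e x \<ge> 0" for x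
      using C01 by (simp add: e_def)
    \<comment> \<open>Multiplying by the Minkowski matrix changes an entry of \<open>g\<close> at
      most by a sign, so moving the perturbation \<open>D\<close> to the other side of g g^(-1) = 1
      isolates that entry.\<close>
    have row: "\<bar>g x $ a $ c\<bar> \<le> 1 + m x * e x" for x a c
    proof -
      have "(\<Sum>b\<in>UNIV. g x $ a $ b * inverse_metric g x $ b $ c) = mat 1 $ a $ c"
        using arg_cong[OF metric_inverse(1)[of x], of "\<lambda>M. M $ a $ c"] by (simp add: matrix_matrix_mult_def)
      moreover have "inverse_metric g x $ b $ c = D b c x + minkowski i $ b $ c" for b
        by (simp add: D_def)
      ultimately have "(\<Sum>b\<in>UNIV. g x $ a $ b * minkowski i $ b $ c)
          = mat 1 $ a $ c - (\<Sum>b\<in>UNIV. g x $ a $ b * D b c x)"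
        by (simp add: distrib_left sum.distrib)
      moreover have "(\<Sum>b\<in>UNIV. g x $ a $ b * minkowski i $ b $ c)
          = (\<Sum>b\<in>UNIV. if b = c then g x $ a $ c * minkowski i $ c $ c else 0)"
        by (intro sum.cong) (auto simp: minkowski_def)
      moreover have "\<bar>minkowski i $ c $ c\<bar> = 1"
        by (simp add: minkowski_def)
      ultimately have "\<bar>g x $ a $ c\<bar> = \<bar>mat 1 $ a $ c - (\<Sum>b\<in>UNIV. g x $ a $ b * D b c x)\<bar>"
        by (simp add: abs_mult) (metis abs_mult mult.right_neutral)
      also have "\<dots> \<le> \<bar>mat 1 $ a $ c\<bar> + \<bar>\<Sum>b\<in>UNIV. g x $ a $ b * D b c x\<bar>"
        by (rule abs_triangle_ineq4)
      also have "\<dots> \<le> 1 + (\<Sum>b\<in>UNIV. \<bar>g x $ a $ b\<bar> * e x)"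
        using D_le by (intro add_mono order_trans[OF sum_abs] sum_mono)
          (auto simp: mat_def abs_mult e_def intro!: mult_left_mono)
      also have "(\<Sum>b\<in>UNIV. \<bar>g x $ a $ b\<bar> * e x) \<le> m x * e x"
        unfolding sum_distrib_right[symmetric] m_def using e
        by (intro mult_right_mono member_le_sum[of a UNIV "\<lambda>a. \<Sum>b\<in>UNIV. \<bar>g x $ a $ b\<bar>"]) (auto intro: sum_nonneg)
      finally show ?thesis
        by simp
    qed
    have m_le: "m x \<le> N\<^sup>2 * (1 + m x * e x)" for x
    proof -
      have "m x \<le> (\<Sum>a\<in>(UNIV :: 'm set). \<Sum>b\<in>(UNIV :: 'm set). 1 + m x * e x)"
        unfolding m_def[of x] by (intro sum_mono) (rule row[unfolded m_def])
      then show ?thesis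
        by (simp add: N_def power2_eq_square algebra_simps)
    qed
    \<comment> \<open>Beyond \<open>R\<close> one has N^2 e \<le> 1/2, so the inequality becomes m
      \<le> N^2 + m/2 and m can be absorbed. Writing C0 + 1 keeps the denominator positive.\<close>
    define R where "R = (2 * N\<^sup>2 * (C0 + 1)) powr (1 / \<mu>)"
    have R: "R > 0" "R powr (- \<mu>) = 1 / (2 * N\<^sup>2 * (C0 + 1))"
    proof -
      define P where "P = 2 * N\<^sup>2 * (C0 + 1)"
      have P: "P > 0"
        using N C01 by (auto simp: P_def intro!: mult_pos_pos add_nonneg_pos)
      then show "R > 0"
        unfolding R_def P_def[symmetric] by simp
      have "R powr (- \<mu>) = P powr (- 1)"
        using mu by (simp add: R_def powr_powr flip: P_def)
      then show "R powr (- \<mu>) = 1 / (2 * N\<^sup>2 * (C0 + 1))"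
        using P by (simp add: powr_minus_divide flip: P_def)
    qed
    have far: "m x \<le> 2 * N\<^sup>2" if "norm x \<ge> R" for x
    proof -
      have "?jb x powr (- \<mu>) \<le> R powr (- \<mu>)"
        using that japanese_bracket_ge(2)[of x] R(1) mu by (intro powr_mono2') auto
      then have "e x \<le> C0 * (1 / (2 * N\<^sup>2 * (C0 + 1)))"
        unfolding e_def R(2)[symmetric] using C01 by (intro mult_left_mono) auto
      then have "N\<^sup>2 * e x \<le> N\<^sup>2 * (C0 * (1 / (2 * N\<^sup>2 * (C0 + 1))))"
        by (intro mult_left_mono) auto
      also have "\<dots> = C0 / (C0 + 1) / 2"
      proof -
        have "N\<^sup>2 \<noteq> 0" "C0 + 1 \<noteq> 0"
          using N C01 by auto
        then show ?thesis
          by (simp add: divide_simps)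
      qed
      also have "\<dots> \<le> 1/2"
        using C01 by simp
      finally have "m x * (N\<^sup>2 * e x) \<le> m x * (1/2)"
        by (intro mult_left_mono) (auto simp: m_def intro!: sum_nonneg)
      then show ?thesis
        using m_le[of x] by (simp add: algebra_simps)
    qed
    have "continuous_on (cball 0 R) m"
      unfolding m_def
      by (intro continuous_intros lipschitz_on_balls_continuous_on smooth_lipschitz_on_balls smooth_metric)
    then have "bounded (m ` cball 0 R)"
      by (intro compact_imp_bounded compact_continuous_image compact_cball)
    then obtain B where "\<forall>x\<in>cball 0 R. \<bar>m x\<bar> \<le> B"
      by (auto simp: bounded_iff)
    then have B: "\<bar>m x\<bar> \<le> B" if "norm x \<le> R" for x
      using that by simp
    have "\<bar>g x $ a $ b\<bar> \<le> max B (2 * N\<^sup>2)" for x a b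
      using g_le_m[of x a b] far[of x] B[of x] by (cases "norm x \<ge> R") auto
    then show ?thesis
      by blast
  qed
  then obtain B where B: "\<And>x a b. \<bar>g x $ a $ b\<bar> \<le> B"
    by blast
  have B0: "B \<ge> 0"
    using B[of 0 i i] by linarith
  define E where "E x = ?jb x powr (- \<mu> - 1)" for x
  have E: "E x \<ge> 0" for x
    by (simp add: E_def)
  define G1 where "G1 = N\<^sup>2 * B\<^sup>2 * C1"
  have G1: "\<bar>partial l (\<lambda>y. g y $ a $ d) x\<bar> \<le> G1 * E x" for l a d x
  proof -
    have diff: "(\<lambda>x. inverse_metric g x $ j $ k) differentiable (at x)" for j k
      using H_deriv differentiable_def by blast
    have "\<bar>partial l (\<lambda>y. g y $ a $ d) x\<bar>
        \<le> (\<Sum>c\<in>UNIV. \<bar>\<Sum>b\<in>UNIV. g x $ a $ b * partial l (D b c) x\<bar> * \<bar>g x $ c $ d\<bar>)"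
      unfolding partial_metric[OF diff] H_partial abs_minus_cancel abs_mult[symmetric] by (rule sum_abs)
    also have "\<dots> \<le> (\<Sum>c\<in>(UNIV :: 'm set). (\<Sum>b\<in>(UNIV :: 'm set). B * (C1 * E x)) * B)"
      using B B0 D'_le C01 E
      by (intro sum_mono mult_mono order_trans[OF sum_abs])
        (auto simp: abs_mult E_def intro!: mult_mono sum_nonneg)
    also have "\<dots> = G1 * E x"
      by (simp add: G1_def N_def power2_eq_square)
    finally show ?thesis .
  qed
  have G1_nonneg: "G1 \<ge> 0"
    using B0 C01 by (simp add: G1_def)
  define K where "K = (1/2) * (N * ((C0 + 1) * (3 * G1)))"
  have K: "\<bar>christoffel g i' j k x\<bar> \<le> K * E x" for i' j k x
  proof -
    have "\<bar>partial j (\<lambda>y. g y $ k $ l) x + partial k (\<lambda>y. g y $ j $ l) x - partial l (\<lambda>y. g y $ j $ k) x\<bar>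
        \<le> 3 * G1 * E x" for l
      using G1[of j k l x] G1[of k j l x] G1[of l j k x] by linarith
    then have "\<bar>\<Sum>l\<in>UNIV. inverse_metric g x $ i' $ l *
        (partial j (\<lambda>y. g y $ k $ l) x + partial k (\<lambda>y. g y $ j $ l) x - partial l (\<lambda>y. g y $ j $ k) x)\<bar>
        \<le> (\<Sum>l\<in>(UNIV :: 'm set). (C0 + 1) * (3 * G1 * E x))"
      using H_le C01 by (intro order_trans[OF sum_abs] sum_mono) (auto simp: abs_mult intro!: mult_mono)
    then show ?thesis
      by (simp add: christoffel_def K_def N_def abs_mult)
  qed
  have K0: "K \<ge> 0"
    using G1_nonneg C01 N by (simp add: K_def)
  \<comment> \<open>N^3 counts the component \<open>i'\<close> and the indices \<open>j\<close>,
    \<open>k\<close>; the power of 2 is the price of replacing the bracket by (1 + |x|)/2; the final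
    1 makes \<open>L\<close> positive.\<close>
  define L where "L = N ^ 3 * K * 2 powr (1 + \<mu>) + 1"
  have "norm (geodesic_acceleration g x v) \<le> L * (1 + norm x) powr (- 1 - \<mu>) * (norm v)\<^sup>2" for x v
  proof -
    have "norm (geodesic_acceleration g x v)
        \<le> (\<Sum>i'\<in>UNIV. \<bar>\<Sum>j\<in>UNIV. \<Sum>k\<in>UNIV. christoffel g i' j k x * v $ j * v $ k\<bar>)"
      using norm_le_l1_cart[of "geodesic_acceleration g x v"] by (simp add: geodesic_acceleration_def)
    also have "\<dots> \<le> (\<Sum>i'\<in>(UNIV :: 'm set). \<Sum>j\<in>(UNIV :: 'm set). \<Sum>k\<in>(UNIV :: 'm set).
        K * E x * norm v * norm v)"
      using K K0 E
      by (intro sum_mono order_trans[OF sum_abs])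
        (auto simp: abs_mult intro!: mult_mono component_le_norm_cart)
    also have "\<dots> = N ^ 3 * K * E x * (norm v)\<^sup>2"
      by (simp add: N_def power2_eq_square power3_eq_cube)
    also have "\<dots> \<le> N ^ 3 * K * (2 powr (1 + \<mu>) * (1 + norm x) powr (- 1 - \<mu>)) * (norm v)\<^sup>2"
    proof -
      have "E x \<le> ((1 + norm x) / 2) powr (- \<mu> - 1)"
        unfolding E_def using japanese_bracket_ge(3)[of x] mu by (intro powr_mono2') (auto simp: add_pos_nonneg)
      also have "\<dots> = 2 powr (1 + \<mu>) * (1 + norm x) powr (- 1 - \<mu>)"
        using powr_minus[of 2 "1 + \<mu>"] by (simp add: powr_divide minus_diff_commute field_simps)
      finally show ?thesis
        using K0 N by (intro mult_right_mono mult_left_mono) auto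
    qed
    also have "\<dots> \<le> L * (1 + norm x) powr (- 1 - \<mu>) * (norm v)\<^sup>2"
      by (simp add: L_def algebra_simps)
    finally show ?thesis .
  qed
  moreover have "L > 0"
    unfolding L_def using K0 N by (intro add_nonneg_pos mult_nonneg_nonneg) auto
  ultimately have "spray (geodesic_acceleration g) L \<mu>"
    using mu lipschitz_on_balls_geodesic_acceleration[OF H_lip] geodesic_acceleration_scaleR
    by unfold_locales auto
  then show ?thesis
    using that by blast
qed

end

section \<open>Completeness\<close>

text \<open>With the energy as \<open>Q\<close>, a bound on \<open>I\<close> produces a maximal null
  geodesic with bounded image, whose closure is compact. It is not constant because its velocity
  never vanishes, so it contradicts null nontrapping.\<close>

lemma nontrapping_maximal_geodesic_unbounded:
  assumes "lorentzian_metric g" "asymptotically_minkowski i g" "null_nontrapping g"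
    and max: "maximal_geodesic g I \<gamma>"
  shows "\<not> bdd_above I"
proof
  assume I: "bdd_above I"
  interpret lorentzian g
    by unfold_locales fact
  obtain \<mu> where "\<mu> > 0"
    "\<And>j k. (\<lambda>x. inverse_metric g x $ j $ k - minkowski i $ j $ k) \<in> symbol_class (- \<mu>)"
    using assms(2) unfolding asymptotically_minkowski_def by blast
  then obtain C where "spray (geodesic_acceleration g) C \<mu>"
    using spray_geodesic_acceleration by blast
  then interpret spray "geodesic_acceleration g" C \<mu> .
  obtain J y w where J: "maximal_motion (geodesic_acceleration g) J y"
    and yw: "trajectory (geodesic_acceleration g) J y w" and bd: "bounded (y ` J)"
    and w: "\<And>t. t \<in> J \<Longrightarrow> w t \<noteq> 0" "\<And>t. t \<in> J \<Longrightarrow> energy g (y t) (w t) = 0"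
    using trapped_null_motion[OF max[unfolded maximal_geodesic_iff_maximal_motion] I
        isCont_energy energy_scaleR energy_conserved] by blast
  have y': "(y has_vector_derivative w t) (at t)" if "t \<in> J" for t
    using yw that by (simp add: trajectory_def)
  have "null_on g J y"
    unfolding null_on_def using w(2) y' vector_derivative_at by (fastforce simp: energy_def)
  moreover obtain t where t: "t \<in> J" and "open J"
    using J unfolding maximal_motion_def motion_def by blast
  have "\<not> y constant_on J"
  proof
    assume "y constant_on J"
    then obtain c where "\<And>t. t \<in> J \<Longrightarrow> c = y t"
      unfolding constant_on_def by metis
    then have "(y has_vector_derivative 0) (at t)"
      using has_vector_derivative_transform_within_open[OF has_vector_derivative_const \<open>open J\<close> t] by blast
    then show False
      using vector_derivative_unique_at[OF y'[OF t]] w(1)[OF t] by blast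
  qed
  ultimately have "\<not> compact (closure (y ` (J \<inter> {t<..})))"
    using assms(3) J t unfolding null_nontrapping_def nontrapping_def forward_nontrapping_def
      maximal_geodesic_iff_maximal_motion by blast
  moreover have "bounded (y ` (J \<inter> {t<..}))"
    using bd by (rule bounded_subset) auto
  ultimately show False
    by (simp add: compact_closure)
qed

theorem theorem1p1:
  fixes n :: nat
    and i\<^sub>1 :: "'m::finite"
    and g :: "real ^ 'm \<Rightarrow> real ^ 'm ^ 'm"
  assumes "n \<ge> 1" and "CARD('m) = n + 1"
    and "lorentzian_metric g"
    and "asymptotically_minkowski i\<^sub>1 g"
    and "null_nontrapping g"
  shows "geodesically_complete g"
  unfolding geodesically_complete_def
proof (intro allI impI)
  fix I \<gamma> assume max: "maximal_geodesic g I \<gamma>"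
  \<comment> \<open>Homogeneity with factor -1: reversed geodesics are geodesics, so an obstruction
    at the lower end becomes one at the upper end.\<close>
  have "geodesic_acceleration g x (- v) = geodesic_acceleration g x v" for x v
    using geodesic_acceleration_scaleR[of g x "-1" v] by simp
  then have "maximal_geodesic g (uminus ` I) (\<lambda>t. \<gamma> (- t))"
    using max maximal_motion_reverse[of "geodesic_acceleration g" I \<gamma>]
    unfolding maximal_geodesic_iff_maximal_motion by blast
  then have "\<not> bdd_above (uminus ` I)" "\<not> bdd_above I"
    using max nontrapping_maximal_geodesic_unbounded[OF assms(3-5)] by blast+
  then have unbounded: "\<not> bdd_below I" "\<not> bdd_above I"
    by simp_all
  show "I = UNIV"
  proof (intro equalityI subset_UNIV subsetI)
    fix t :: real
    obtain r s where "r \<in> I" "r < t" "s \<in> I" "t < s"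
      using unbounded unfolding bdd_below_def bdd_above_def by (meson not_le)
    then show "t \<in> I"
      using max unfolding maximal_geodesic_def geodesic_on_def is_interval_1 by (meson less_imp_le)
  qed
qed

end
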